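(* If an instance $\mathcal I$ has finite partitionwidth, then every 2RPE-extension of $\mathcal I$ and every FO-extension of $\mathcal I$ has finite partitionwidth.
   Context: Instances: for a finite signature $\Sigma$ (relation symbols with arities $\ge1$, containing unary $\top$) and a finite set $\mathrm{Cnst}$ of constants, an instance is a countable set of atoms whose terms are constants or nulls; $\mathrm{adom}$ is its set of terms; isomorphism is a bijection of terms fixing constants mapping atoms onto atoms; $\mathrm{ar}(\Sigma)$ is the maximal arity. Extensions: two-way regular path expressions (2RPEs) over $\Sigma$ are regular expressions over the alphabet $\{P^\rightarrow,P^\leftarrow\mid P\in\Sigma \text{ binary}\}$, interpreted in $\mathcal I$ as binary relations on $\mathrm{adom}(\mathcal I)$: $(P^\rightarrow)^{\mathcal I}=\{(t_1,t_2)\mid P(t_1,t_2)\in\mathcal I\}$, $(P^\leftarrow)^{\mathcal I}=\{(t_2,t_1)\mid P(t_1,t_2)\in\mathcal I\}$, concatenation as relational composition, union as union, and $(E^* )^{\mathcal I}$ as the reflexive (on $\mathrm{adom}(\mathcal I)$) transitive closure. For binary $P\in\Sigma$ and 2RPE $E$, the 2RPE-extension is $\mathcal I^{P:=P\cup E}=\mathcal I\cup\{P(t,t')\mid(t,t')\in E^{\mathcal I}\}$. For $R\in\Sigma$ and a first-order formula $\varphi(\vec x)$ with $|\vec x|=\mathrm{ar}(R)$ free variables, the FO-extension is $\mathcal I^{R:=R\cup\varphi}=\mathcal I\cup\{R(\vec t)\mid\mathcal I\models\varphi(\vec t)\}$. Partitionwidth: let $\mathbb L$ be a finite set of colors, each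 with an arity $\mathrm{ar}(\lambda)\in\mathbb N_+$, containing distinguished colors $o_i$ of arity $i$ for $1\le i\le\mathrm{ar}(\Sigma)$. For a $k$-tuple $\vec a$, an $m$-tuple $\vec b$ and $I\subsetneq\{1,\dots,k+m\}$ with $|I|=k$, $\vec a\,{+}{+}_I\,\vec b$ is the $(k+m)$-tuple carrying $a_1,\dots,a_k$ (in order) at positions in $I$ and $b_1,\dots,b_m$ (in order) elsewhere; extended elementwise to sets. Instructions: $\mathrm{Add}(\kappa,\mu,I\to\lambda)$ ($\mathrm{ar}\kappa+\mathrm{ar}\mu=\mathrm{ar}\lambda$, $I\subsetneq\{1..\mathrm{ar}\lambda\}$, $|I|=\mathrm{ar}\kappa$); $\mathrm{Recol}^i(\kappa\to\lambda)$ ($i\in\{0,1\}$, equal arities); $\mathrm{RAdd}(\kappa,\mu,I\to R)$ ($R\in\Sigma$, $\mathrm{ar}\kappa+\mathrm{ar}\mu=\mathrm{ar}R$, $I\subsetneq\{1..\mathrm{ar}R\}$, $|I|=\mathrm{ar}\kappa$); $\mathrm{Mat}^i(\kappa\to R)$ ($\mathrm{ar}\kappa=\mathrm{ar}R$). Two Add (resp. two $\mathrm{Recol}^i$) instructions differing only in the target color are incompatible. A well-decorated tree labels each node $s\in\{0,1\}^*$ of the infinite binary tree with a set of decorators from $\{*\}\cup\mathrm{Cnst}\cup\{\text{instructions}\}$ so that: a node labeled $*$ or a constant (pseudoleaf) has no other label; proper descendants of pseudoleaves are unlabeled; each constant labels at most one node; no node carries incompatible instructions. Entities of $s$: nodes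 $ss'$ labeled $*$ and constants labeling some $ss'$. Recursively: at a pseudoleaf labeled $c$ (resp. $*$), $\mathrm{col}_s(o_i)=\{(c,\dots,c)\}$ (resp. $\{(s,\dots,s)\}$, length $i$), other colors empty; otherwise $\mathrm{col}_s(\lambda)$ is the union of $\mathrm{col}_{s0}(\kappa)\,{+}{+}_I\,\mathrm{col}_{s1}(\mu)$ over $\mathrm{Add}(\kappa,\mu,I\to\lambda)$ at $s$, of $\mathrm{col}_{si}(\kappa)$ over $\mathrm{Recol}^i(\kappa\to\lambda)$ at $s$, and for each $i$ of $\mathrm{col}_{si}(\lambda)$ unless some $\mathrm{Recol}^i(\lambda\to\kappa)$ is at $s$. $\mathrm{Atoms}_s$ is $\{\top(c)\}$ / $\{\top(s)\}$ at pseudoleaves, else all $R(\vec e)$ with $\vec e\in\mathrm{col}_{s0}(\kappa)\,{+}{+}_I\,\mathrm{col}_{s1}(\mu)$ for an $\mathrm{RAdd}(\kappa,\mu,I\to R)$ at $s$, or $\vec e\in\mathrm{col}_{si}(\kappa)$ for a $\mathrm{Mat}^i(\kappa\to R)$ at $s$. The represented instance is $\bigcup_s\mathrm{Atoms}_s$. The partitionwidth of $\mathcal I$ is the least $|\mathbb L|$ such that $\mathcal I$ is isomorphic to an instance represented by a well-decorated tree over $\mathbb L$ ($\infty$ if none); finite partitionwidth means it is a natural number. *)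

theory Defs
  imports Main "HOL-Library.Countable_Set" "HOL-Library.Extended_Nat"
begin

section \<open>Signatures and instances\<close>

record ('r, 'c) sig =
  rels :: "'r set"
  ar :: "'r \<Rightarrow> nat"
  Top :: 'r
  cnst :: "'c set"

definition signature :: "('r, 'c) sig \<Rightarrow> bool" where
  "signature S \<longleftrightarrow> finite (rels S) \<and> (\<forall>R\<in>rels S. 1 \<le> ar S R)
     \<and> Top S \<in> rels S \<and> ar S (Top S) = 1 \<and> finite (cnst S)"

definition max_ar :: "('r, 'c) sig \<Rightarrow> nat" where
  "max_ar S = Max (ar S ` rels S)"

datatype ('c, 'n) trm = Cst 'c | Null 'n

datatype ('r, 't) atom = Atom 'r "'t list"

primrec atom_terms :: "('r, 't) atom \<Rightarrow> 't set" where
  "atom_terms (Atom R ts) = set ts"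

definition adom :: "('r, 't) atom set \<Rightarrow> 't set" where
  "adom I = (\<Union>\<alpha>\<in>I. atom_terms \<alpha>)"

definition is_instance :: "('r, 'c) sig \<Rightarrow> ('r, ('c, 'n) trm) atom set \<Rightarrow> bool" where
  "is_instance S I \<longleftrightarrow> countable I
     \<and> (\<forall>R ts. Atom R ts \<in> I \<longrightarrow> R \<in> rels S \<and> length ts = ar S R)
     \<and> (\<forall>c. Cst c \<in> adom I \<longrightarrow> c \<in> cnst S)"

text \<open>
  Constants are fixed in both directions: a null is never mapped to a constant, so that the
  inverse of an isomorphism is again an isomorphism.
\<close>

definition isomorphic ::
  "('r, ('c, 'n) trm) atom set \<Rightarrow> ('r, ('c, 'm) trm) atom set \<Rightarrow> bool" where
  "isomorphic I J \<longleftrightarrow> (\<exists>f. bij_betw f (adom I) (adom J)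
     \<and> (\<forall>t\<in>adom I. \<forall>c. f t = Cst c \<longleftrightarrow> t = Cst c)
     \<and> (\<lambda>\<alpha>. case \<alpha> of Atom R ts \<Rightarrow> Atom R (map f ts)) ` I = J)"


section \<open>Extensions by two-way regular path expressions\<close>

datatype 'r rpe =
    Fwd 'r
  | Bwd 'r
  | Zero
  | One
  | Comp "'r rpe" "'r rpe"
  | Plus "'r rpe" "'r rpe"
  | Star "'r rpe"

primrec rpe_over :: "('r, 'c) sig \<Rightarrow> 'r rpe \<Rightarrow> bool" where
  "rpe_over S (Fwd P) \<longleftrightarrow> P \<in> rels S \<and> ar S P = 2"
| "rpe_over S (Bwd P) \<longleftrightarrow> P \<in> rels S \<and> ar S P = 2"
| "rpe_over S Zero \<longleftrightarrow> True"
| "rpe_over S One \<longleftrightarrow> True"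
| "rpe_over S (Comp E F) \<longleftrightarrow> rpe_over S E \<and> rpe_over S F"
| "rpe_over S (Plus E F) \<longleftrightarrow> rpe_over S E \<and> rpe_over S F"
| "rpe_over S (Star E) \<longleftrightarrow> rpe_over S E"

primrec rpe_rel :: "('r, 't) atom set \<Rightarrow> 'r rpe \<Rightarrow> ('t \<times> 't) set" where
  "rpe_rel I (Fwd P) = {(t, u). Atom P [t, u] \<in> I}"
| "rpe_rel I (Bwd P) = {(u, t). Atom P [t, u] \<in> I}"
| "rpe_rel I Zero = {}"
| "rpe_rel I One = Id_on (adom I)"
| "rpe_rel I (Comp E F) = rpe_rel I E O rpe_rel I F"
| "rpe_rel I (Plus E F) = rpe_rel I E \<union> rpe_rel I F"
| "rpe_rel I (Star E) = Id_on (adom I) \<union> (rpe_rel I E)\<^sup>+"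

definition rpe_extension :: "('r, 't) atom set \<Rightarrow> 'r \<Rightarrow> 'r rpe \<Rightarrow> ('r, 't) atom set" where
  "rpe_extension I P E = I \<union> {Atom P [t, u] | t u. (t, u) \<in> rpe_rel I E}"


section \<open>Extensions by first-order formulas\<close>

datatype 'c fo_trm = FVar nat | FCst 'c

datatype ('r, 'c) fo =
    FAtom 'r "'c fo_trm list"
  | FEq "'c fo_trm" "'c fo_trm"
  | FNeg "('r, 'c) fo"
  | FConj "('r, 'c) fo" "('r, 'c) fo"
  | FDisj "('r, 'c) fo" "('r, 'c) fo"
  | FImp "('r, 'c) fo" "('r, 'c) fo"
  | FEx nat "('r, 'c) fo"
  | FAll nat "('r, 'c) fo"

primrec trm_fv :: "'c fo_trm \<Rightarrow> nat set" where
  "trm_fv (FVar x) = {x}"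
| "trm_fv (FCst c) = {}"

primrec trm_over :: "('r, 'c) sig \<Rightarrow> 'c fo_trm \<Rightarrow> bool" where
  "trm_over S (FVar x) \<longleftrightarrow> True"
| "trm_over S (FCst c) \<longleftrightarrow> c \<in> cnst S"

primrec trm_val :: "(nat \<Rightarrow> ('c, 'n) trm) \<Rightarrow> 'c fo_trm \<Rightarrow> ('c, 'n) trm" where
  "trm_val v (FVar x) = v x"
| "trm_val v (FCst c) = Cst c"

primrec fv :: "('r, 'c) fo \<Rightarrow> nat set" where
  "fv (FAtom R ts) = (\<Union>t\<in>set ts. trm_fv t)"
| "fv (FEq t u) = trm_fv t \<union> trm_fv u"
| "fv (FNeg \<phi>) = fv \<phi>"
| "fv (FConj \<phi> \<psi>) = fv \<phi> \<union> fv \<psi>"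
| "fv (FDisj \<phi> \<psi>) = fv \<phi> \<union> fv \<psi>"
| "fv (FImp \<phi> \<psi>) = fv \<phi> \<union> fv \<psi>"
| "fv (FEx x \<phi>) = fv \<phi> - {x}"
| "fv (FAll x \<phi>) = fv \<phi> - {x}"

primrec fo_over :: "('r, 'c) sig \<Rightarrow> ('r, 'c) fo \<Rightarrow> bool" where
  "fo_over S (FAtom R ts) \<longleftrightarrow>
     R \<in> rels S \<and> length ts = ar S R \<and> (\<forall>t\<in>set ts. trm_over S t)"
| "fo_over S (FEq t u) \<longleftrightarrow> trm_over S t \<and> trm_over S u"
| "fo_over S (FNeg \<phi>) \<longleftrightarrow> fo_over S \<phi>"
| "fo_over S (FConj \<phi> \<psi>) \<longleftrightarrow> fo_over S \<phi> \<and> fo_over S \<psi>"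
| "fo_over S (FDisj \<phi> \<psi>) \<longleftrightarrow> fo_over S \<phi> \<and> fo_over S \<psi>"
| "fo_over S (FImp \<phi> \<psi>) \<longleftrightarrow> fo_over S \<phi> \<and> fo_over S \<psi>"
| "fo_over S (FEx x \<phi>) \<longleftrightarrow> fo_over S \<phi>"
| "fo_over S (FAll x \<phi>) \<longleftrightarrow> fo_over S \<phi>"

text \<open>
  The domain of quantification is the active domain; constants denote themselves, whether or not
  they occur in the instance.
\<close>

primrec sat ::
  "('r, ('c, 'n) trm) atom set \<Rightarrow> (nat \<Rightarrow> ('c, 'n) trm) \<Rightarrow> ('r, 'c) fo \<Rightarrow> bool" where
  "sat I v (FAtom R ts) \<longleftrightarrow> Atom R (map (trm_val v) ts) \<in> I"
| "sat I v (FEq t u) \<longleftrightarrow> trm_val v t = trm_val v u"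
| "sat I v (FNeg \<phi>) \<longleftrightarrow> \<not> sat I v \<phi>"
| "sat I v (FConj \<phi> \<psi>) \<longleftrightarrow> sat I v \<phi> \<and> sat I v \<psi>"
| "sat I v (FDisj \<phi> \<psi>) \<longleftrightarrow> sat I v \<phi> \<or> sat I v \<psi>"
| "sat I v (FImp \<phi> \<psi>) \<longleftrightarrow> (sat I v \<phi> \<longrightarrow> sat I v \<psi>)"
| "sat I v (FEx x \<phi>) \<longleftrightarrow> (\<exists>t\<in>adom I. sat I (v(x := t)) \<phi>)"
| "sat I v (FAll x \<phi>) \<longleftrightarrow> (\<forall>t\<in>adom I. sat I (v(x := t)) \<phi>)"

text \<open>
  The list \<open>xs\<close> enumerates the free variables of \<open>\<phi>\<close>; the tuple substituted for it is \<open>map v xs\<close>.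
\<close>

definition fo_extension ::
  "('r, ('c, 'n) trm) atom set \<Rightarrow> 'r \<Rightarrow> nat list \<Rightarrow> ('r, 'c) fo
     \<Rightarrow> ('r, ('c, 'n) trm) atom set" where
  "fo_extension I R xs \<phi> = I \<union> {Atom R (map v xs) | v. v ` set xs \<subseteq> adom I \<and> sat I v \<phi>}"


section \<open>Partitionwidth\<close>

text \<open>
  Only the number and arities of colors matter, so colors are drawn from the natural numbers;
  \<open>orig L i\<close> is the distinguished color \<open>o\<^sub>i\<close>.
\<close>

record palette =
  colors :: "nat set"
  car :: "nat \<Rightarrow> nat"
  orig :: "nat \<Rightarrow> nat"

definition palette_for :: "('r, 'c) sig \<Rightarrow> palette \<Rightarrow> bool" where
  "palette_for S L \<longleftrightarrow> finite (colors L) \<and> (\<forall>\<kappa>\<in>colors L. 1 \<le> car L \<kappa>)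
     \<and> (\<forall>i\<in>{1..max_ar S}. orig L i \<in> colors L \<and> car L (orig L i) = i)"

text \<open>
  \<open>weave I as bs\<close> carries \<open>as\<close> at the positions in \<open>I\<close> and \<open>bs\<close> at the others; positions are
  counted from 1.
\<close>

definition weave :: "nat set \<Rightarrow> 'a list \<Rightarrow> 'a list \<Rightarrow> 'a list" where
  "weave I as bs = map (\<lambda>j. if j \<in> I then as ! card {i \<in> {1..<j}. i \<in> I}
                             else bs ! card {i \<in> {1..<j}. i \<notin> I})
                       [1..<length as + length bs + 1]"

text \<open>Nodes of the binary tree are lists of directions; \<open>False\<close> is 0 and \<open>True\<close> is 1.\<close>

type_synonym node = "bool list"

datatype ('r, 'c) decorator =
    DStar
  | DCst 'c
  | Add nat nat "nat set" nat
  | Recol bool nat nat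
  | RAdd nat nat "nat set" 'r
  | Mat bool nat 'r

primrec decorator_over :: "('r, 'c) sig \<Rightarrow> palette \<Rightarrow> ('r, 'c) decorator \<Rightarrow> bool" where
  "decorator_over S L DStar \<longleftrightarrow> True"
| "decorator_over S L (DCst c) \<longleftrightarrow> c \<in> cnst S"
| "decorator_over S L (Add \<kappa> \<mu> I \<nu>) \<longleftrightarrow> {\<kappa>, \<mu>, \<nu>} \<subseteq> colors L
     \<and> car L \<kappa> + car L \<mu> = car L \<nu> \<and> I \<subset> {1..car L \<nu>} \<and> card I = car L \<kappa>"
| "decorator_over S L (Recol i \<kappa> \<nu>) \<longleftrightarrow> {\<kappa>, \<nu>} \<subseteq> colors L \<and> car L \<kappa> = car L \<nu>"
| "decorator_over S L (RAdd \<kappa> \<mu> I R) \<longleftrightarrow> {\<kappa>, \<mu>} \<subseteq> colors L \<and> R \<in> rels S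
     \<and> car L \<kappa> + car L \<mu> = ar S R \<and> I \<subset> {1..ar S R} \<and> card I = car L \<kappa>"
| "decorator_over S L (Mat i \<kappa> R) \<longleftrightarrow> \<kappa> \<in> colors L \<and> R \<in> rels S \<and> car L \<kappa> = ar S R"

definition pseudoleaf :: "(node \<Rightarrow> ('r, 'c) decorator set) \<Rightarrow> node \<Rightarrow> bool" where
  "pseudoleaf T s \<longleftrightarrow> DStar \<in> T s \<or> (\<exists>c. DCst c \<in> T s)"

definition well_decorated ::
  "('r, 'c) sig \<Rightarrow> palette \<Rightarrow> (node \<Rightarrow> ('r, 'c) decorator set) \<Rightarrow> bool" where
  "well_decorated S L T \<longleftrightarrow>
     (\<forall>s. \<forall>d\<in>T s. decorator_over S L d)
   \<and> (\<forall>s. DStar \<in> T s \<longrightarrow> T s = {DStar})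
   \<and> (\<forall>s c. DCst c \<in> T s \<longrightarrow> T s = {DCst c})
   \<and> (\<forall>s s'. pseudoleaf T s \<and> s' \<noteq> [] \<longrightarrow> T (s @ s') = {})
   \<and> (\<forall>c s s'. DCst c \<in> T s \<and> DCst c \<in> T s' \<longrightarrow> s = s')
   \<and> (\<forall>s \<kappa> \<mu> I \<nu> \<nu>'. Add \<kappa> \<mu> I \<nu> \<in> T s \<and> Add \<kappa> \<mu> I \<nu>' \<in> T s \<longrightarrow> \<nu> = \<nu>')
   \<and> (\<forall>s i \<kappa> \<nu> \<nu>'. Recol i \<kappa> \<nu> \<in> T s \<and> Recol i \<kappa> \<nu>' \<in> T s \<longrightarrow> \<nu> = \<nu>')"

text \<open>
  \<open>in_col S L T s \<nu> es\<close> means \<open>es \<in> col\<^sub>s(\<nu>)\<close>. The recursion runs from a node to its children in an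
  infinite tree; it is well-founded because tuples consist of entities of \<open>s\<close>, each of which sits at
  a pseudoleaf finitely far below \<open>s\<close>. The least fixed point captures precisely this.
\<close>

inductive in_col ::
  "('r, 'c) sig \<Rightarrow> palette \<Rightarrow> (node \<Rightarrow> ('r, 'c) decorator set)
     \<Rightarrow> node \<Rightarrow> nat \<Rightarrow> ('c, node) trm list \<Rightarrow> bool"
  for S :: "('r, 'c) sig" and L :: palette and T :: "node \<Rightarrow> ('r, 'c) decorator set" where
  leaf_cst: "DCst c \<in> T s \<Longrightarrow> i \<in> {1..max_ar S}
    \<Longrightarrow> in_col S L T s (orig L i) (replicate i (Cst c))"
| leaf_star: "DStar \<in> T s \<Longrightarrow> i \<in> {1..max_ar S}
    \<Longrightarrow> in_col S L T s (orig L i) (replicate i (Null s))"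
| add: "\<not> pseudoleaf T s \<Longrightarrow> Add \<kappa> \<mu> I \<nu> \<in> T s
    \<Longrightarrow> in_col S L T (s @ [False]) \<kappa> as \<Longrightarrow> in_col S L T (s @ [True]) \<mu> bs
    \<Longrightarrow> in_col S L T s \<nu> (weave I as bs)"
| recol: "\<not> pseudoleaf T s \<Longrightarrow> Recol i \<kappa> \<nu> \<in> T s
    \<Longrightarrow> in_col S L T (s @ [i]) \<kappa> as \<Longrightarrow> in_col S L T s \<nu> as"
| keep: "\<not> pseudoleaf T s \<Longrightarrow> \<forall>\<kappa>. Recol i \<nu> \<kappa> \<notin> T s
    \<Longrightarrow> in_col S L T (s @ [i]) \<nu> as \<Longrightarrow> in_col S L T s \<nu> as"

definition atoms_at ::
  "('r, 'c) sig \<Rightarrow> palette \<Rightarrow> (node \<Rightarrow> ('r, 'c) decorator set)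
     \<Rightarrow> node \<Rightarrow> ('r, ('c, node) trm) atom set" where
  "atoms_at S L T s =
     (if pseudoleaf T s
      then {Atom (Top S) [Cst c] | c. DCst c \<in> T s}
         \<union> (if DStar \<in> T s then {Atom (Top S) [Null s]} else {})
      else {Atom R (weave I as bs) | R I as bs.
              \<exists>\<kappa> \<mu>. RAdd \<kappa> \<mu> I R \<in> T s
                \<and> in_col S L T (s @ [False]) \<kappa> as \<and> in_col S L T (s @ [True]) \<mu> bs}
         \<union> {Atom R as | R as. \<exists>i \<kappa>. Mat i \<kappa> R \<in> T s \<and> in_col S L T (s @ [i]) \<kappa> as})"

definition represented ::
  "('r, 'c) sig \<Rightarrow> palette \<Rightarrow> (node \<Rightarrow> ('r, 'c) decorator set)
     \<Rightarrow> ('r, ('c, node) trm) atom set" where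
  "represented S L T = (\<Union>s. atoms_at S L T s)"

definition partitionwidth :: "('r, 'c) sig \<Rightarrow> ('r, ('c, 'n) trm) atom set \<Rightarrow> enat" where
  "partitionwidth S I =
     (INF L \<in> {L. palette_for S L \<and>
                  (\<exists>T. well_decorated S L T \<and> isomorphic I (represented S L T))}.
        enat (card (colors L)))"

definition finite_partitionwidth :: "('r, 'c) sig \<Rightarrow> ('r, ('c, 'n) trm) atom set \<Rightarrow> bool" where
  "finite_partitionwidth S I \<longleftrightarrow> (\<exists>k. partitionwidth S I = enat k)"

end

theory Submission
  imports Defs "HOL-Library.FuncSet" "HOL-Library.Sublist"
begin

text \<open>
  Finite partitionwidth is a Myhill-Nerode property. Place the terms of an instance at an antichain
  of nodes of the binary tree, and call two tuples of terms below a node \<open>s\<close> equivalent if no context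
  of terms outside \<open>s\<close> distinguishes them with respect to the relations of the instance. The instance
  has finite partitionwidth iff, for some placement, the number of classes is bounded uniformly
  in \<open>s\<close>: the colors of a tuple below \<open>s\<close> determine its class, and conversely the classes can serve as
  colors because they are a congruence for weaving.

  For a fixed placement the relations with uniformly bounded index are closed under everything
  needed. Boolean operations are immediate. For a quantifier or a composition, either the witness
  lies outside \<open>s\<close>, or only the set of classes of the witnesses below \<open>s\<close> matters. For a transitive
  closure, only the rows of the vertices from which a path can leave \<open>s\<close> matter.
\<close>

section \<open>Relations of bounded index\<close>

text \<open>The decorated tree of the given instance is never transformed. Only the addresses of its
  pseudoleaves and the resulting bounds survive; the index of the extension is bounded over the same
  addresses, and a new tree is built whose colors are classes of the extension itself. This works
  because both extensions keep the active domain: a pseudoleaf always contributes its own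
  \<open>Top\<close> atom, so a representable instance carries that atom on every term, and an
  extension with the same domain inherits all of them.

  The obstacle is uniformity: one bound must serve all nodes of an infinite tree, although
  quantifiers, compositions and stars exponentiate it. Each closure lemma therefore derives its
  bound from the earlier bounds alone. Indices are measured for predicates on total valuations, with
  an arbitrary set \<open>V\<close> of variables placed inside the subtree; atoms, formulas with
  constants and binary relations then share one notion, and a quantifier merely moves one variable
  into or out of \<open>V\<close>. Transitive closure is not first-order, so path expressions are
  treated through the rows of a relation and of its converse.\<close>

definition few :: "nat \<Rightarrow> ('a \<Rightarrow> 'b) \<Rightarrow> 'a set \<Rightarrow> bool" where
  "few N f A \<longleftrightarrow> finite (f ` A) \<and> card (f ` A) \<le> N"

lemma few_mono: "few N f A \<Longrightarrow> N \<le> M \<Longrightarrow> few M f A"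
  by (auto simp: few_def)

lemma few_subset: "f ` A \<subseteq> B \<Longrightarrow> finite B \<Longrightarrow> card B \<le> N \<Longrightarrow> few N f A"
  unfolding few_def by (meson card_mono finite_subset le_trans)

lemma few_const: "(\<And>a. a \<in> A \<Longrightarrow> f a = c) \<Longrightarrow> few 1 f A"
  by (rule few_subset[where B = "{c}"]) auto

lemma few_two: "(\<And>a. a \<in> A \<Longrightarrow> f a = c \<or> f a = d) \<Longrightarrow> few 2 f A"
  by (rule few_subset[where B = "{c, d}"]) (auto simp: card_insert_if)

lemma few_compose: "few N g A \<Longrightarrow> (\<And>a. a \<in> A \<Longrightarrow> f a = h (g a)) \<Longrightarrow> few N f A"
proof -
  assume g: "few N g A" and f: "\<And>a. a \<in> A \<Longrightarrow> f a = h (g a)"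
  have "f ` A = h ` g ` A"
    unfolding image_image by (rule image_cong[OF refl f])
  then show "few N f A"
    using g card_image_le[of "g ` A" h] unfolding few_def by (metis finite_imageI le_trans)
qed

text \<open>Choosing a representative in each fibre of \<open>g\<close> yields the mediating
  function required by \<open>few_compose\<close>, so it suffices to compare values
  pairwise.\<close>

lemma few_determined:
  assumes "few N g A" and "\<And>a a'. a \<in> A \<Longrightarrow> a' \<in> A \<Longrightarrow> g a = g a' \<Longrightarrow> f a = f a'"
  shows "few N f A"
proof (rule few_compose[OF assms(1), where h = "\<lambda>y. f (SOME a. a \<in> A \<and> g a = y)"])
  fix a assume a: "a \<in> A"
  then have "(SOME b. b \<in> A \<and> g b = g a) \<in> A \<and> g (SOME b. b \<in> A \<and> g b = g a) = g a"
    by - (rule someI[where P = "\<lambda>b. b \<in> A \<and> g b = g a" and x = a], simp)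
  then show "f a = f (SOME b. b \<in> A \<and> g b = g a)"
    using assms(2)[OF a] by metis
qed

lemma few_reindex: "few N f B \<Longrightarrow> k ` A \<subseteq> B \<Longrightarrow> few N (\<lambda>a. f (k a)) A"
  by (rule few_subset[where B = "f ` B"]) (auto simp: few_def)

lemma few_Pair:
  assumes "few N f A" and "few M g A"
  shows "few (N * M) (\<lambda>a. (f a, g a)) A"
proof (rule few_subset[where B = "f ` A \<times> g ` A"])
  show "card (f ` A \<times> g ` A) \<le> N * M"
    using assms by (simp add: few_def card_cartesian_product mult_le_mono)
qed (use assms in \<open>auto simp: few_def\<close>)

text \<open>The source of the powers of two for quantifiers, compositions and closures:
  \<open>g a\<close> is a set of values of \<open>f\<close>, taken on a possibly different domain
  \<open>B\<close>.\<close>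

lemma few_Pow:
  assumes "few N f B" and "\<And>a. a \<in> A \<Longrightarrow> g a \<subseteq> f ` B"
  shows "few (2 ^ N) g A"
proof (rule few_subset[where B = "Pow (f ` B)"])
  show "card (Pow (f ` B)) \<le> 2 ^ N"
    using assms(1) by (simp add: few_def card_Pow)
qed (use assms in \<open>auto simp: few_def\<close>)

lemma few_restrict:
  assumes "finite K" and "\<And>k. k \<in> K \<Longrightarrow> few N (f k) A"
  shows "few (N ^ card K) (\<lambda>a. restrict (\<lambda>k. f k a) K) A"
proof (rule few_subset[where B = "PiE K (\<lambda>k. f k ` A)"])
  have "(\<Prod>k\<in>K. card (f k ` A)) \<le> (\<Prod>k\<in>K. N)"
    using assms by (intro prod_mono) (auto simp: few_def)
  then show "card (PiE K (\<lambda>k. f k ` A)) \<le> N ^ card K"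
    using assms(1) by (simp add: card_PiE)
qed (use assms in \<open>auto simp: few_def intro!: finite_PiE\<close>)

section \<open>Index of a predicate across a set of terms, and its first-order closure
  properties\<close>

text \<open>The Myhill-Nerode class of \<open>v\<close>: \<open>V\<close> holds the variables whose
  values lie inside \<open>X\<close>, and \<open>w\<close> is the context. Contexts are total
  valuations, so that they can be compared for all \<open>v\<close>; their values on
  \<open>V\<close> are overwritten.\<close>

definition out_profile ::
  "nat set \<Rightarrow> ((nat \<Rightarrow> 't) \<Rightarrow> bool) \<Rightarrow> nat set \<Rightarrow> 't set \<Rightarrow> (nat \<Rightarrow> 't) \<Rightarrow> (nat \<Rightarrow> 't) set" where
  "out_profile U \<rho> V X v = {w. (\<forall>x\<in>U - V. w x \<notin> X) \<and> \<rho> (override_on w v V)}"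

text \<open>Letting \<open>V\<close> range over all sets of variables covers every distribution of
  the arguments between the inside and the outside of \<open>X\<close>. The single \<open>N\<close>
  is what later makes the palette finite.\<close>

definition bounded_index :: "'t set set \<Rightarrow> nat set \<Rightarrow> ((nat \<Rightarrow> 't) \<Rightarrow> bool) \<Rightarrow> bool" where
  "bounded_index \<S> U \<rho> \<longleftrightarrow>
     (\<exists>N. \<forall>V. \<forall>X\<in>\<S>. few N (out_profile U \<rho> V X) {v. \<forall>x\<in>V. v x \<in> X})"

lemma bounded_indexI:
  assumes "\<And>V X. X \<in> \<S> \<Longrightarrow> few N (out_profile U \<rho> V X) {v. \<forall>x\<in>V. v x \<in> X}"
  shows "bounded_index \<S> U \<rho>"
  using assms unfolding bounded_index_def by blast

text \<open>A larger \<open>U\<close> only forbids more contexts, so each new profile is cut out of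
  the old one.\<close>

lemma bounded_index_mono:
  assumes "bounded_index \<S> U \<rho>" and "U \<subseteq> U'"
  shows "bounded_index \<S> U' \<rho>"
proof -
  obtain N where N: "\<And>V X. X \<in> \<S> \<Longrightarrow> few N (out_profile U \<rho> V X) {v. \<forall>x\<in>V. v x \<in> X}"
    using assms(1) unfolding bounded_index_def by blast
  show ?thesis
  proof (rule bounded_indexI)
    fix V X assume "X \<in> \<S>"
    show "few N (out_profile U' \<rho> V X) {v. \<forall>x\<in>V. v x \<in> X}"
      by (rule few_compose[OF N[OF \<open>X \<in> \<S>\<close>],
            where h = "\<lambda>Q. {w\<in>Q. \<forall>x\<in>U' - V. w x \<notin> X}"])
        (use assms(2) in \<open>auto simp: out_profile_def\<close>)
  qed
qed

lemma bounded_index_neg: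
  assumes "bounded_index \<S> U \<rho>"
  shows "bounded_index \<S> U (\<lambda>v. \<not> \<rho> v)"
proof -
  obtain N where N: "\<And>V X. X \<in> \<S> \<Longrightarrow> few N (out_profile U \<rho> V X) {v. \<forall>x\<in>V. v x \<in> X}"
    using assms(1) unfolding bounded_index_def by blast
  show ?thesis
  proof (rule bounded_indexI)
    fix V X assume "X \<in> \<S>"
    show "few N (out_profile U (\<lambda>v. \<not> \<rho> v) V X) {v. \<forall>x\<in>V. v x \<in> X}"
      by (rule few_compose[OF N[OF \<open>X \<in> \<S>\<close>],
            where h = "\<lambda>Q. {w. \<forall>x\<in>U - V. w x \<notin> X} - Q"])
        (auto simp: out_profile_def)
  qed
qed

lemma bounded_index_conj:
  assumes "bounded_index \<S> U \<rho>" and "bounded_index \<S> U \<sigma>"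
  shows "bounded_index \<S> U (\<lambda>v. \<rho> v \<and> \<sigma> v)"
proof -
  obtain N where N: "\<And>V X. X \<in> \<S> \<Longrightarrow> few N (out_profile U \<rho> V X) {v. \<forall>x\<in>V. v x \<in> X}"
    using assms(1) unfolding bounded_index_def by blast
  obtain M where M: "\<And>V X. X \<in> \<S> \<Longrightarrow> few M (out_profile U \<sigma> V X) {v. \<forall>x\<in>V. v x \<in> X}"
    using assms(2) unfolding bounded_index_def by blast
  show ?thesis
  proof (rule bounded_indexI)
    fix V X assume "X \<in> \<S>"
    show "few (N * M) (out_profile U (\<lambda>v. \<rho> v \<and> \<sigma> v) V X) {v. \<forall>x\<in>V. v x \<in> X}"
      by (rule few_compose[OF few_Pair[OF N[OF \<open>X \<in> \<S>\<close>] M[OF \<open>X \<in> \<S>\<close>]],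
            where h = "\<lambda>(P, Q). P \<inter> Q"])
        (auto simp: out_profile_def)
  qed
qed

lemma bounded_index_disj:
  assumes "bounded_index \<S> U \<rho>" and "bounded_index \<S> U \<sigma>"
  shows "bounded_index \<S> U (\<lambda>v. \<rho> v \<or> \<sigma> v)"
  using bounded_index_neg[OF bounded_index_conj[OF bounded_index_neg[OF assms(1)]
        bounded_index_neg[OF assms(2)]]] by simp

lemma bounded_index_True: "bounded_index \<S> U (\<lambda>v. True)"
  by (rule bounded_indexI, rule few_const) (simp add: out_profile_def)

lemma bounded_index_Ball:
  assumes "finite F" and "\<And>i. i \<in> F \<Longrightarrow> bounded_index \<S> U (\<rho> i)"
  shows "bounded_index \<S> U (\<lambda>v. \<forall>i\<in>F. \<rho> i v)"
  using assms
  by (induction F rule: finite_induct) (auto intro: bounded_index_True bounded_index_conj)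

text \<open>Serves atoms with repeated variables and constants: \<open>Inl y\<close> reads the
  variable \<open>y\<close>, \<open>Inr c\<close> inserts the fixed term \<open>c\<close>. The bound
  does not grow, because the new profile is cut out of the preimage of an old one.\<close>

lemma bounded_index_subst:
  fixes \<sigma> :: "nat \<Rightarrow> nat + 't"
  assumes "bounded_index \<S> U \<rho>" and "\<And>i y. i \<in> U \<Longrightarrow> \<sigma> i = Inl y \<Longrightarrow> y \<in> U'"
  shows "bounded_index \<S> U' (\<lambda>v. \<rho> (\<lambda>i. case_sum v id (\<sigma> i)))"
proof -
  obtain N where N: "\<And>V X. X \<in> \<S> \<Longrightarrow> few N (out_profile U \<rho> V X) {v. \<forall>x\<in>V. v x \<in> X}"
    using assms(1) unfolding bounded_index_def by blast
  show ?thesis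
  proof (rule bounded_indexI)
    fix V X assume "X \<in> \<S>"
    \<comment> \<open>A position counts as inside when its variable does, or when its constant
      happens to lie in \<open>X\<close>; otherwise such a constant would be an illegal context
      value.\<close>
    define V' where "V' = {i. case_sum (\<lambda>y. y \<in> V) (\<lambda>c. c \<in> X) (\<sigma> i)}"
    define s where "s = (\<lambda>(v :: nat \<Rightarrow> 't) i. case_sum v id (\<sigma> i))"
    have ov: "s (override_on w v V) = override_on (s w) (s v) V'" for v w
      by (rule ext) (auto simp: s_def V'_def override_on_def split: sum.splits)
    have in': "s v \<in> {v. \<forall>x\<in>V'. v x \<in> X}" if "\<forall>x\<in>V. v x \<in> X" for v
      using that by (auto simp: s_def V'_def split: sum.splits)
    have out: "\<forall>x\<in>U - V'. s w x \<notin> X" if "\<forall>x\<in>U' - V. w x \<notin> X" for w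
      using that assms(2) by (auto simp: s_def V'_def split: sum.splits)
    have "few N (\<lambda>v. out_profile U \<rho> V' X (s v)) {v. \<forall>x\<in>V. v x \<in> X}"
      by (rule few_reindex[OF N[OF \<open>X \<in> \<S>\<close>]]) (use in' in blast)
    then have "few N (out_profile U' (\<lambda>v. \<rho> (s v)) V X) {v. \<forall>x\<in>V. v x \<in> X}"
      by (rule few_compose[where h = "\<lambda>Q. {w. (\<forall>x\<in>U' - V. w x \<notin> X) \<and> s w \<in> Q}"])
        (use out in \<open>auto simp: out_profile_def ov\<close>)
    then show "few N (out_profile U' (\<lambda>v. \<rho> (\<lambda>i. case_sum v id (\<sigma> i))) V X) {v. \<forall>x\<in>V. v x \<in> X}"
      by (simp add: s_def)
  qed
qed

text \<open>A witness outside \<open>X\<close> extends the context, a witness inside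
  \<open>X\<close> extends \<open>v\<close>. The former are governed by one profile, with
  \<open>x\<close> removed from \<open>V\<close>; the latter by the set of profiles that they
  produce. Hence the bound \<open>N * 2 ^ N\<close>.\<close>

lemma bounded_index_Ex:
  assumes "bounded_index \<S> U \<rho>"
  shows "bounded_index \<S> (U - {x}) (\<lambda>v. \<exists>t\<in>D. \<rho> (v(x := t)))"
proof -
  obtain N where N: "\<And>V X. X \<in> \<S> \<Longrightarrow> few N (out_profile U \<rho> V X) {v. \<forall>x\<in>V. v x \<in> X}"
    using assms(1) unfolding bounded_index_def by blast
  show ?thesis
  proof (rule bounded_indexI)
    fix V :: "nat set" and X assume X: "X \<in> \<S>"
    let ?A = "{v. \<forall>x\<in>V. v x \<in> X}"
    let ?in = "\<lambda>v. (\<lambda>t. out_profile U \<rho> (insert x V) X (v(x := t))) ` (D \<inter> X)"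
    have 1: "few N (out_profile U \<rho> (V - {x}) X) ?A"
      using few_reindex[OF N[OF X, where V = "V - {x}"], where k = id and A = ?A] by auto
    have 2: "few (2 ^ N) ?in ?A"
      by (rule few_Pow[OF N[OF X, where V = "insert x V"]]) auto
    \<comment> \<open>The bound variable may already belong to \<open>V\<close>; since the update at
      \<open>x\<close> comes last, it can be read as part of the context or as part of
      \<open>v\<close>.\<close>
    have out: "(override_on w v V)(x := t) = override_on (w(x := t)) v (V - {x})" for w v t
      by (auto simp: override_on_def)
    have ins: "(override_on w v V)(x := t) = override_on w (v(x := t)) (insert x V)" for w v t
      by (auto simp: override_on_def)
    have key: "w \<in> out_profile (U - {x}) (\<lambda>v. \<exists>t\<in>D. \<rho> (v(x := t))) V X v \<longleftrightarrow>
        (\<forall>y\<in>U - {x} - V. w y \<notin> X) \<and>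
        ((\<exists>t\<in>D - X. w(x := t) \<in> out_profile U \<rho> (V - {x}) X v) \<or> (\<exists>Q\<in>?in v. w \<in> Q))" for v w
    proof (cases "\<forall>y\<in>U - {x} - V. w y \<notin> X")
      case True
      have o: "w(x := t) \<in> out_profile U \<rho> (V - {x}) X v \<longleftrightarrow> \<rho> ((override_on w v V)(x := t))"
        if "t \<notin> X" for t
        using that True unfolding out out_profile_def by auto
      have i: "w \<in> out_profile U \<rho> (insert x V) X (v(x := t)) \<longleftrightarrow> \<rho> ((override_on w v V)(x := t))"
        for t
        using True unfolding ins out_profile_def by auto
      have "w \<in> out_profile (U - {x}) (\<lambda>v. \<exists>t\<in>D. \<rho> (v(x := t))) V X v \<longleftrightarrow>
          (\<exists>t\<in>D. \<rho> ((override_on w v V)(x := t)))"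
        using True by (simp add: out_profile_def)
      with True o i show ?thesis by auto
    qed (auto simp: out_profile_def)
    show "few (N * 2 ^ N) (out_profile (U - {x}) (\<lambda>v. \<exists>t\<in>D. \<rho> (v(x := t))) V X) ?A"
      by (rule few_compose[OF few_Pair[OF 1 2], where h = "\<lambda>(P, Q). {w. (\<forall>y\<in>U - {x} - V. w y \<notin> X)
            \<and> ((\<exists>t\<in>D - X. w(x := t) \<in> P) \<or> (\<exists>C\<in>Q. w \<in> C))}"], rule set_eqI, subst key) simp
  qed
qed

section \<open>Binary relations through the rows that leave a set\<close>

text \<open>A one-sided index: the first argument is inside \<open>X\<close>, the second outside.
  Composition and closure act on each side separately, and the converse relation supplies the other
  side.\<close>

definition few_rows :: "'t set set \<Rightarrow> ('t \<times> 't) set \<Rightarrow> bool" where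
  "few_rows \<S> E \<longleftrightarrow> (\<exists>N. \<forall>X\<in>\<S>. few N (\<lambda>a. E `` {a} - X) X)"

lemma few_rows_empty: "few_rows \<S> {}"
  unfolding few_rows_def by (intro exI[of _ 1] ballI few_const[where c = "{}"]) auto

lemma few_rows_Id_on: "few_rows \<S> (Id_on D)"
  unfolding few_rows_def by (intro exI[of _ 1] ballI few_const[where c = "{}"]) auto

lemma few_rows_Un:
  assumes "few_rows \<S> E" and "few_rows \<S> F"
  shows "few_rows \<S> (E \<union> F)"
proof -
  obtain N M where N: "\<And>X. X \<in> \<S> \<Longrightarrow> few N (\<lambda>a. E `` {a} - X) X"
    and M: "\<And>X. X \<in> \<S> \<Longrightarrow> few M (\<lambda>a. F `` {a} - X) X"
    using assms unfolding few_rows_def by blast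
  show ?thesis
    unfolding few_rows_def
  proof (intro exI ballI)
    fix X assume "X \<in> \<S>"
    show "few (N * M) (\<lambda>a. (E \<union> F) `` {a} - X) X"
      by (rule few_compose[OF few_Pair[OF N[OF \<open>X \<in> \<S>\<close>] M[OF \<open>X \<in> \<S>\<close>]],
            where h = "\<lambda>(P, Q). P \<union> Q"]) auto
  qed
qed

text \<open>A middle vertex outside \<open>X\<close> is listed in the row of \<open>a\<close> under
  \<open>E\<close>; for the middle vertices inside \<open>X\<close> only the set of their rows under
  \<open>F\<close> matters.\<close>

lemma few_rows_relcomp:
  assumes "few_rows \<S> E" and "few_rows \<S> F"
  shows "few_rows \<S> (E O F)"
proof -
  obtain N M where N: "\<And>X. X \<in> \<S> \<Longrightarrow> few N (\<lambda>a. E `` {a} - X) X"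
    and M: "\<And>X. X \<in> \<S> \<Longrightarrow> few M (\<lambda>a. F `` {a} - X) X"
    using assms unfolding few_rows_def by blast
  show ?thesis
    unfolding few_rows_def
  proof (intro exI ballI)
    fix X assume X: "X \<in> \<S>"
    let ?g = "\<lambda>a. (\<lambda>c. F `` {c} - X) ` (E `` {a} \<inter> X)"
    have "few (2 ^ M) ?g X"
      by (rule few_Pow[OF M[OF X]]) auto
    from few_Pair[OF N[OF X] this]
    show "few (N * 2 ^ M) (\<lambda>a. (E O F) `` {a} - X) X"
    proof (rule few_compose)
      fix a assume "a \<in> X"
      show "(E O F) `` {a} - X = (\<lambda>(P, Q). (F `` P - X) \<union> \<Union>Q) (E `` {a} - X, ?g a)"
        by auto
    qed
  qed
qed

text \<open>
  A path that leaves \<open>X\<close> is determined, from its first exit on, by the row of the last vertex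
  before the exit.
\<close>

lemma few_rows_trancl:
  assumes "few_rows \<S> E"
  shows "few_rows \<S> (E\<^sup>+)"
proof -
  obtain N where N: "\<And>X. X \<in> \<S> \<Longrightarrow> few N (\<lambda>a. E `` {a} - X) X"
    using assms unfolding few_rows_def by blast
  show ?thesis
    unfolding few_rows_def
  proof (intro exI ballI)
    fix X assume X: "X \<in> \<S>"
    \<comment> \<open>\<open>?g a\<close> collects the rows of all vertices reachable without
      leaving \<open>X\<close>. Past the first exit a path may re-enter \<open>X\<close> at will, so
      the exit targets are later closed under the full \<open>E\<^sup>*\<close>.\<close>
    let ?g = "\<lambda>a. (\<lambda>c. E `` {c} - X) ` ((E \<inter> X \<times> X)\<^sup>* `` {a})"
    have stay: "c \<in> X" if "(a, c) \<in> (E \<inter> X \<times> X)\<^sup>*" "a \<in> X" for a c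
      using that by (induction rule: rtrancl_induct) auto
    have sub: "(E \<inter> X \<times> X)\<^sup>* \<subseteq> E\<^sup>*"
      by (rule rtrancl_mono) auto
    have exit: "\<exists>c d. (a, c) \<in> (E \<inter> X \<times> X)\<^sup>* \<and> (c, d) \<in> E \<and> d \<notin> X \<and> (d, b) \<in> E\<^sup>*"
      if "(a, b) \<in> E\<^sup>*" "a \<in> X" "b \<notin> X" for a b
      using that
    proof (induction rule: converse_rtrancl_induct)
      case (step a a')
      show ?case
      proof (cases "a' \<in> X")
        case True
        with step obtain c d where "(a', c) \<in> (E \<inter> X \<times> X)\<^sup>*" "(c, d) \<in> E" "d \<notin> X" "(d, b) \<in> E\<^sup>*"
          by blast
        moreover have "(a, a') \<in> E \<inter> X \<times> X"
          using step True by auto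
        ultimately show ?thesis by (meson converse_rtrancl_into_rtrancl)
      next
        case False
        with step show ?thesis by blast
      qed
    qed simp
    have "few (2 ^ N) ?g X"
      by (rule few_Pow[OF N[OF X]]) (use stay in auto)
    then show "few (2 ^ N) (\<lambda>a. E\<^sup>+ `` {a} - X) X"
    proof (rule few_compose)
      fix a assume a: "a \<in> X"
      show "E\<^sup>+ `` {a} - X = (\<lambda>Q. E\<^sup>* `` \<Union>Q - X) (?g a)"
      proof (rule set_eqI, rule iffI)
        fix b assume "b \<in> E\<^sup>+ `` {a} - X"
        then have "(a, b) \<in> E\<^sup>*" "b \<notin> X" by auto
        with exit[OF _ a] show "b \<in> E\<^sup>* `` \<Union>(?g a) - X"
          by blast
      next
        fix b assume "b \<in> E\<^sup>* `` \<Union>(?g a) - X"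
        then obtain c d where "(a, c) \<in> (E \<inter> X \<times> X)\<^sup>*" "(c, d) \<in> E" "(d, b) \<in> E\<^sup>*" "b \<notin> X"
          by blast
        then show "b \<in> E\<^sup>+ `` {a} - X"
          using sub by (metis DiffI Image_singleton_iff rtrancl_into_trancl1 subsetD trancl_rtrancl_trancl)
      qed
    qed
  qed
qed

text \<open>Placing exactly one of the two variables inside gives the rows or the columns; placing
  both or neither gives at most two profiles.\<close>

lemma bounded_index_rel:
  "bounded_index \<S> {..<2} (\<lambda>v. (v 0, v 1) \<in> E) \<longleftrightarrow> few_rows \<S> E \<and> few_rows \<S> (E\<inverse>)"
proof
  assume "bounded_index \<S> {..<2} (\<lambda>v. (v 0, v 1) \<in> E)"
  then obtain N where N: "\<And>V X. X \<in> \<S> \<Longrightarrow>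
      few N (out_profile {..<2} (\<lambda>v. (v 0, v 1) \<in> E) V X) {v. \<forall>x\<in>V. v x \<in> X}"
    unfolding bounded_index_def by blast
  \<comment> \<open>Constant valuations suffice: one variable is read from \<open>a\<close>, the
    other from the context.\<close>
  have N': "few N (\<lambda>a. out_profile {..<2} (\<lambda>v. (v 0, v 1) \<in> E) V X (\<lambda>_. a)) X" if "X \<in> \<S>" for V X
    by (rule few_reindex[OF N[OF that]]) auto
  have row: "few N (\<lambda>a. E `` {a} - X) X" if "X \<in> \<S>" for X
    by (rule few_compose[OF N'[OF that, where V = "{0}"], where h = "\<lambda>Q. {b. b \<notin> X \<and> (\<lambda>_. b) \<in> Q}"])
      (auto simp: out_profile_def)
  have col: "few N (\<lambda>a. E\<inverse> `` {a} - X) X" if "X \<in> \<S>" for X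
    by (rule few_compose[OF N'[OF that, where V = "{1}"], where h = "\<lambda>Q. {b. b \<notin> X \<and> (\<lambda>_. b) \<in> Q}"])
      (auto simp: out_profile_def)
  show "few_rows \<S> E \<and> few_rows \<S> (E\<inverse>)"
    unfolding few_rows_def using row col by blast
next
  assume "few_rows \<S> E \<and> few_rows \<S> (E\<inverse>)"
  then obtain N M where N: "\<And>X. X \<in> \<S> \<Longrightarrow> few N (\<lambda>a. E `` {a} - X) X"
    and M: "\<And>X. X \<in> \<S> \<Longrightarrow> few M (\<lambda>a. E\<inverse> `` {a} - X) X"
    unfolding few_rows_def by blast
  have lt2: "{..<2} = {0, 1::nat}" by auto
  show "bounded_index \<S> {..<2} (\<lambda>v. (v 0, v 1) \<in> E)"
  proof (rule bounded_indexI)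
    fix V :: "nat set" and X assume X: "X \<in> \<S>"
    let ?f = "out_profile {..<2} (\<lambda>v. (v 0, v 1) \<in> E) V X" and ?A = "{v. \<forall>x\<in>V. v x \<in> X}"
    consider "0 \<in> V" "1 \<in> V" | "0 \<in> V" "1 \<notin> V" | "0 \<notin> V" "1 \<in> V" | "0 \<notin> V" "1 \<notin> V"
      by blast
    then show "few (N + M + 2) ?f ?A"
    proof cases
      case 1
      \<comment> \<open>With both variables inside, no context is consulted, so a profile is
        everything or nothing.\<close>
      have "few 2 ?f ?A"
        by (rule few_two[where c = "{}" and d = UNIV]) (use 1 in \<open>auto simp: out_profile_def lt2\<close>)
      then show ?thesis by (rule few_mono) simp
    next
      case 2
      have "few N (\<lambda>v. E `` {v 0} - X) ?A"
        by (rule few_reindex[OF N[OF X]]) (use 2 in auto)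
      then have "few N ?f ?A"
        by (rule few_compose[where h = "\<lambda>Q. {w. w 1 \<in> Q}"]) (use 2 in \<open>auto simp: out_profile_def lt2\<close>)
      then show ?thesis by (rule few_mono) simp
    next
      case 3
      have "few M (\<lambda>v. E\<inverse> `` {v 1} - X) ?A"
        by (rule few_reindex[OF M[OF X]]) (use 3 in auto)
      then have "few M ?f ?A"
        by (rule few_compose[where h = "\<lambda>Q. {w. w 0 \<in> Q}"]) (use 3 in \<open>auto simp: out_profile_def lt2\<close>)
      then show ?thesis by (rule few_mono) simp
    next
      case 4
      have "few 1 ?f ?A"
        by (rule few_const[where c = "{w. w 0 \<notin> X \<and> w 1 \<notin> X \<and> (w 0, w 1) \<in> E}"])
          (use 4 in \<open>auto simp: out_profile_def lt2\<close>)
      then show ?thesis by (rule few_mono) simp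
    qed
  qed
qed

text \<open>Used to confine the new tuples of a first-order extension to the active domain. A unary
  test never sees both sides of \<open>X\<close>, so two profiles are enough.\<close>

lemma bounded_index_mem: "bounded_index \<S> {x} (\<lambda>v. v x \<in> D)"
proof (rule bounded_indexI)
  fix V X assume "X \<in> \<S>"
  show "few 2 (out_profile {x} (\<lambda>v. v x \<in> D) V X) {v. \<forall>y\<in>V. v y \<in> X}"
  proof (cases "x \<in> V")
    case True
    then show ?thesis
      by (intro few_two[where c = "{}" and d = UNIV]) (auto simp: out_profile_def)
  next
    case False
    have "few 1 (out_profile {x} (\<lambda>v. v x \<in> D) V X) {v. \<forall>y\<in>V. v y \<in> X}"
      by (rule few_const[where c = "{w. w x \<notin> X \<and> w x \<in> D}"]) (use False in \<open>auto simp: out_profile_def\<close>)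
    then show ?thesis by (rule few_mono) simp
  qed
qed

section \<open>Instances of bounded index and their extensions\<close>

definition bounded_instance ::
  "('r, 'c) sig \<Rightarrow> 't set set \<Rightarrow> ('r, 't) atom set \<Rightarrow> bool" where
  "bounded_instance S \<S> I \<longleftrightarrow>
     (\<forall>R\<in>rels S. bounded_index \<S> {..<ar S R} (\<lambda>v. Atom R (map v [0..<ar S R]) \<in> I))"

lemma bounded_index_Atom2:
  assumes "ar S P = 2"
  shows "bounded_index \<S> {..<ar S P} (\<lambda>v. Atom P (map v [0..<ar S P]) \<in> I) \<longleftrightarrow>
    few_rows \<S> {(t, u). Atom P [t, u] \<in> I} \<and> few_rows \<S> ({(t, u). Atom P [t, u] \<in> I}\<inverse>)"
proof -
  have "(\<lambda>v. Atom P (map v [0..<ar S P]) \<in> I) = (\<lambda>v. (v 0, v 1) \<in> {(t, u). Atom P [t, u] \<in> I})"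
    using assms by (simp add: numeral_2_eq_2 upt_rec)
  then show ?thesis
    using assms by (simp only: bounded_index_rel)
qed

text \<open>Rows and columns are carried through the induction together, because a backward letter
  exchanges them.\<close>

lemma few_rows_rpe:
  assumes "bounded_instance S \<S> I" and "rpe_over S E"
  shows "few_rows \<S> (rpe_rel I E) \<and> few_rows \<S> ((rpe_rel I E)\<inverse>)"
  using assms(2)
proof (induction E)
  case (Fwd P)
  then show ?case
    using assms(1) bounded_index_Atom2[of S P \<S> I]
    by (auto simp: bounded_instance_def)
next
  case (Bwd P)
  have "rpe_rel I (Bwd P) = {(t, u). Atom P [t, u] \<in> I}\<inverse>" by auto
  with Bwd show ?case
    using assms(1) bounded_index_Atom2[of S P \<S> I]
    by (auto simp: bounded_instance_def)
qed (simp_all add: few_rows_empty few_rows_Id_on few_rows_Un few_rows_relcomp few_rows_trancl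
    converse_relcomp converse_Un flip: trancl_converse)

lemma bounded_instance_rpe_extension:
  assumes I: "bounded_instance S \<S> I" and "rpe_over S E" and P: "ar S P = 2"
  shows "bounded_instance S \<S> (rpe_extension I P E)"
  unfolding bounded_instance_def
proof
  fix R assume R: "R \<in> rels S"
  show "bounded_index \<S> {..<ar S R} (\<lambda>v. Atom R (map v [0..<ar S R]) \<in> rpe_extension I P E)"
  proof (cases "R = P")
    case True
    have eq: "{(t, u). Atom P [t, u] \<in> rpe_extension I P E} = {(t, u). Atom P [t, u] \<in> I} \<union> rpe_rel I E"
      by (auto simp: rpe_extension_def)
    have "few_rows \<S> {(t, u). Atom P [t, u] \<in> I} \<and> few_rows \<S> ({(t, u). Atom P [t, u] \<in> I}\<inverse>)"
      using I R True P bounded_index_Atom2[OF P, of \<S> I]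
      by (auto simp: bounded_instance_def)
    with few_rows_rpe[OF I \<open>rpe_over S E\<close>] show ?thesis
      unfolding True bounded_index_Atom2[OF P] eq
      by (simp add: few_rows_Un converse_Un)
  next
    case False
    then have "Atom R ts \<in> rpe_extension I P E \<longleftrightarrow> Atom R ts \<in> I" for ts
      by (auto simp: rpe_extension_def)
    with I R show ?thesis by (simp add: bounded_instance_def)
  qed
qed

lemma bounded_index_sat:
  fixes I :: "('r, ('c, 'n) trm) atom set"
  assumes "bounded_instance S \<S> I" and "fo_over S \<phi>"
  shows "bounded_index \<S> (fv \<phi>) (\<lambda>v. sat I v \<phi>)"
  using assms(2)
proof (induction \<phi>)
  case (FAtom R ts)
  \<comment> \<open>Each argument position is redirected to the variable or constant written there;
    a repeated variable makes the substitution non-injective.\<close>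
  let ?\<sigma> = "\<lambda>i. case ts ! i of FVar x \<Rightarrow> Inl x | FCst c \<Rightarrow> Inr (Cst c)"
  have "bounded_index \<S> {..<length ts} (\<lambda>v. Atom R (map v [0..<length ts]) \<in> I)"
    using FAtom assms(1) by (simp add: bounded_instance_def)
  then have "bounded_index \<S> (fv (FAtom R ts))
      (\<lambda>v. Atom R (map (\<lambda>i. case_sum v id (?\<sigma> i)) [0..<length ts]) \<in> I)"
    by (rule bounded_index_subst) (auto split: fo_trm.splits dest!: nth_mem intro!: bexI)
  moreover have "map (\<lambda>i. case_sum v id (?\<sigma> i)) [0..<length ts] = map (trm_val v) ts"
    for v :: "nat \<Rightarrow> ('c, 'n) trm"
    by (rule nth_equalityI) (auto split: fo_trm.splits)
  ultimately show ?case by simp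
next
  case (FEq t u)
  let ?\<sigma> = "\<lambda>i::nat. case (if i = 0 then t else u) of FVar x \<Rightarrow> Inl x | FCst c \<Rightarrow> Inr (Cst c)"
  \<comment> \<open>Equality is the identity relation, whose rows never leave a set.\<close>
  have "bounded_index \<S> {..<2} (\<lambda>v. (v 0, v 1) \<in> Id_on UNIV)"
    unfolding bounded_index_rel by (simp add: few_rows_Id_on)
  then have "bounded_index \<S> (fv (FEq t u))
      (\<lambda>v. (case_sum v id (?\<sigma> 0), case_sum v id (?\<sigma> 1)) \<in> Id_on UNIV)"
    by (rule bounded_index_subst[where \<sigma> = ?\<sigma>]) (auto split: fo_trm.splits if_splits)
  moreover have "case_sum v id (case r of FVar x \<Rightarrow> Inl x | FCst c \<Rightarrow> Inr (Cst c)) = trm_val v r"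
    for r and v :: "nat \<Rightarrow> ('c, 'n) trm"
    by (cases r) auto
  ultimately show ?case by (simp add: Id_on_iff)
next
  case (FNeg \<phi>)
  then show ?case by (simp add: bounded_index_neg)
next
  case (FConj \<phi> \<psi>)
  have "bounded_index \<S> (fv (FConj \<phi> \<psi>)) (\<lambda>v. sat I v \<phi>)"
    by (rule bounded_index_mono[OF FConj.IH(1)]) (use FConj.prems in auto)
  moreover have "bounded_index \<S> (fv (FConj \<phi> \<psi>)) (\<lambda>v. sat I v \<psi>)"
    by (rule bounded_index_mono[OF FConj.IH(2)]) (use FConj.prems in auto)
  ultimately show ?case by (simp add: bounded_index_conj)
next
  case (FDisj \<phi> \<psi>)
  have "bounded_index \<S> (fv (FDisj \<phi> \<psi>)) (\<lambda>v. sat I v \<phi>)"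
    by (rule bounded_index_mono[OF FDisj.IH(1)]) (use FDisj.prems in auto)
  moreover have "bounded_index \<S> (fv (FDisj \<phi> \<psi>)) (\<lambda>v. sat I v \<psi>)"
    by (rule bounded_index_mono[OF FDisj.IH(2)]) (use FDisj.prems in auto)
  ultimately show ?case by (simp add: bounded_index_disj)
next
  case (FImp \<phi> \<psi>)
  have 1: "bounded_index \<S> (fv (FImp \<phi> \<psi>)) (\<lambda>v. \<not> sat I v \<phi>)"
    by (rule bounded_index_mono[OF bounded_index_neg[OF FImp.IH(1)]]) (use FImp.prems in auto)
  have 2: "bounded_index \<S> (fv (FImp \<phi> \<psi>)) (\<lambda>v. sat I v \<psi>)"
    by (rule bounded_index_mono[OF FImp.IH(2)]) (use FImp.prems in auto)
  from bounded_index_disj[OF 1 2] show ?case by simp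
next
  case (FEx x \<phi>)
  then show ?case using bounded_index_Ex[of \<S> "fv \<phi>" "\<lambda>v. sat I v \<phi>"] by simp
next
  case (FAll x \<phi>)
  then have "bounded_index \<S> (fv \<phi> - {x}) (\<lambda>v. \<not> (\<exists>t\<in>adom I. \<not> sat I (v(x := t)) \<phi>))"
    using bounded_index_neg[OF bounded_index_Ex[OF bounded_index_neg[of \<S> "fv \<phi>" "\<lambda>v. sat I v \<phi>"]]]
    by simp
  then show ?case by simp
qed

lemma trm_val_cong: "(\<And>x. x \<in> trm_fv t \<Longrightarrow> v x = w x) \<Longrightarrow> trm_val v t = trm_val w t"
  by (cases t) auto

lemma sat_cong: "(\<And>x. x \<in> fv \<phi> \<Longrightarrow> v x = w x) \<Longrightarrow> sat I v \<phi> = sat I w \<phi>"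
proof (induction \<phi> arbitrary: v w)
  case (FAtom R ts)
  have "map (trm_val v) ts = map (trm_val w) ts"
    by (rule map_cong[OF refl], rule trm_val_cong) (use FAtom in auto)
  then show ?case by (simp only: sat.simps)
next
  case (FEq t u)
  then show ?case using trm_val_cong[of t v w] trm_val_cong[of u v w] by auto
next
  case (FNeg \<phi>)
  then show ?case by (metis fv.simps(3) sat.simps(3))
next
  case (FConj \<phi> \<psi>)
  from FConj.IH(1)[of v w] FConj.IH(2)[of v w] FConj.prems show ?case by simp
next
  case (FDisj \<phi> \<psi>)
  from FDisj.IH(1)[of v w] FDisj.IH(2)[of v w] FDisj.prems show ?case by simp
next
  case (FImp \<phi> \<psi>)
  from FImp.IH(1)[of v w] FImp.IH(2)[of v w] FImp.prems show ?case by simp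
next
  case (FEx x \<phi>)
  have "sat I (v(x := t)) \<phi> = sat I (w(x := t)) \<phi>" for t
    by (rule FEx.IH) (use FEx.prems in auto)
  then show ?case by simp
next
  case (FAll x \<phi>)
  have "sat I (v(x := t)) \<phi> = sat I (w(x := t)) \<phi>" for t
    by (rule FAll.IH) (use FAll.prems in auto)
  then show ?case by simp
qed

lemma bounded_instance_fo_extension:
  fixes I :: "('r, ('c, 'n) trm) atom set"
  assumes I: "bounded_instance S \<S> I" and "fo_over S \<phi>"
    and xs: "distinct xs" "fv \<phi> = set xs" "length xs = ar S R"
  shows "bounded_instance S \<S> (fo_extension I R xs \<phi>)"
  unfolding bounded_instance_def
proof
  fix Q assume Q: "Q \<in> rels S"
  show "bounded_index \<S> {..<ar S Q} (\<lambda>v. Atom Q (map v [0..<ar S Q]) \<in> fo_extension I R xs \<phi>)"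
  proof (cases "Q = R")
    case True
    let ?n = "ar S R"
    \<comment> \<open>\<open>idx\<close> inverts the enumeration \<open>xs\<close>, which is
      possible by distinctness; \<open>\<phi>\<close> can then be evaluated on valuations of
      argument positions.\<close>
    define idx where "idx x = (THE i. i < ?n \<and> xs ! i = x)" for x
    have idx: "idx (xs ! i) = i" if "i < ?n" for i
      unfolding idx_def using that xs by (auto simp: nth_eq_iff_index_eq)
    have "bounded_index \<S> {..<?n} (\<lambda>v. sat I (\<lambda>x. case_sum v id (Inl (idx x))) \<phi>)"
    proof (rule bounded_index_subst[OF bounded_index_sat[OF I \<open>fo_over S \<phi>\<close>]])
      fix x y assume "x \<in> fv \<phi>" "Inl (idx x) = (Inl y :: nat + ('c, 'n) trm)"
      then show "y \<in> {..<?n}"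
        using xs idx by (auto simp: in_set_conv_nth)
    qed
    \<comment> \<open>The formula alone does not keep its free variables in the active domain, for
      instance when it is a negated atom.\<close>
    moreover have "bounded_index \<S> {..<?n} (\<lambda>v. \<forall>i\<in>{..<?n}. v i \<in> adom I)"
      by (rule bounded_index_Ball) (auto intro: bounded_index_mono[OF bounded_index_mem])
    moreover have "bounded_index \<S> {..<?n} (\<lambda>v. Atom R (map v [0..<?n]) \<in> I)"
      using I Q True by (simp add: bounded_instance_def)
    ultimately have "bounded_index \<S> {..<?n} (\<lambda>v. Atom R (map v [0..<?n]) \<in> I \<or>
        ((\<forall>i\<in>{..<?n}. v i \<in> adom I) \<and> sat I (\<lambda>x. v (idx x)) \<phi>))"
      by (intro bounded_index_disj bounded_index_conj) simp_all
    moreover have "Atom R (map v [0..<?n]) \<in> fo_extension I R xs \<phi> \<longleftrightarrow> Atom R (map v [0..<?n]) \<in> I \<or>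
        ((\<forall>i\<in>{..<?n}. v i \<in> adom I) \<and> sat I (\<lambda>x. v (idx x)) \<phi>)" for v
    proof -
      have "(\<exists>w. map v [0..<?n] = map w xs \<and> w ` set xs \<subseteq> adom I \<and> sat I w \<phi>) \<longleftrightarrow>
          ((\<forall>i\<in>{..<?n}. v i \<in> adom I) \<and> sat I (\<lambda>x. v (idx x)) \<phi>)" (is "?l \<longleftrightarrow> ?r")
      proof
        assume ?l
        then obtain w where w: "map v [0..<?n] = map w xs" "w ` set xs \<subseteq> adom I" "sat I w \<phi>"
          by blast
        have vw: "v i = w (xs ! i)" if "i < ?n" for i
          using arg_cong[OF w(1), of "\<lambda>l. l ! i"] that xs by simp
        have "sat I (\<lambda>x. v (idx x)) \<phi> = sat I w \<phi>"
          by (rule sat_cong) (use xs idx vw in \<open>auto simp: in_set_conv_nth\<close>)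
        with w vw xs show ?r by auto
      next
        assume ?r
        moreover have "map v [0..<?n] = map (\<lambda>x. v (idx x)) xs"
          by (rule nth_equalityI) (use xs idx in auto)
        moreover have "(\<lambda>x. v (idx x)) ` set xs \<subseteq> adom I"
          using \<open>?r\<close> xs idx by (auto simp: in_set_conv_nth)
        ultimately show ?l by blast
      qed
      then show ?thesis by (auto simp: fo_extension_def)
    qed
    ultimately show ?thesis unfolding True by simp
  next
    case False
    then have "Atom Q ts \<in> fo_extension I R xs \<phi> \<longleftrightarrow> Atom Q ts \<in> I" for ts
      by (auto simp: fo_extension_def)
    with I Q show ?thesis by (simp add: bounded_instance_def)
  qed
qed

lemma adom_fo_extension: "adom (fo_extension I R xs \<phi>) = adom I"
  by (auto simp: adom_def fo_extension_def)

lemma rpe_rel_adom: "rpe_rel I E \<subseteq> adom I \<times> adom I"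
proof (induction E)
  case (Star E)
  then have "(rpe_rel I E)\<^sup>+ \<subseteq> adom I \<times> adom I"
    by (rule trancl_subset_Sigma)
  then show ?case by auto
qed (force simp: adom_def)+

lemma adom_rpe_extension: "adom (rpe_extension I P E) = adom I"
  using rpe_rel_adom[of I E] by (fastforce simp: adom_def rpe_extension_def)

section \<open>Weaving\<close>

text \<open>The rank of a position within \<open>I\<close> is the index at which
  \<open>weave\<close> reads its first list. It is strictly increasing on \<open>I\<close> and stays
  below \<open>card I\<close>, hence a bijection by counting.\<close>

lemma rank_bij:
  fixes I :: "nat set"
  assumes "I \<subseteq> {1..n}"
  shows "bij_betw (\<lambda>j. card {i\<in>{1..<j}. i \<in> I}) I {..<card I}"
proof -
  let ?r = "\<lambda>j. card {i\<in>{1..<j}. i \<in> I}"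
  have fin: "finite I"
    using assms by (rule finite_subset) simp
  have less: "?r j < ?r k" if "j \<in> I" "j < k" for j k
  proof (rule psubset_card_mono)
    have "j \<in> {i\<in>{1..<k}. i \<in> I} - {i\<in>{1..<j}. i \<in> I}"
      using that assms by auto
    moreover have "{i\<in>{1..<j}. i \<in> I} \<subseteq> {i\<in>{1..<k}. i \<in> I}"
      using that by auto
    ultimately show "{i\<in>{1..<j}. i \<in> I} \<subset> {i\<in>{1..<k}. i \<in> I}"
      by blast
  qed simp
  have "inj_on ?r I"
  proof (rule inj_onI)
    fix j k assume "j \<in> I" "k \<in> I" "?r j = ?r k"
    then show "j = k"
      using less[of j k] less[of k j] by (cases j k rule: linorder_cases) auto
  qed
  moreover have "?r ` I \<subseteq> {..<card I}"
  proof
    fix r assume "r \<in> ?r ` I"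
    then obtain j where j: "j \<in> I" "r = ?r j" by blast
    then have "{i\<in>{1..<j}. i \<in> I} \<subset> I" by auto
    with fin j show "r \<in> {..<card I}" by (simp add: psubset_card_mono)
  qed
  ultimately have "?r ` I = {..<card I}"
    by (intro card_subset_eq) (simp_all add: card_image)
  with \<open>inj_on ?r I\<close> show ?thesis
    by (simp add: bij_betw_def)
qed

lemma rank_less:
  fixes I :: "nat set"
  assumes "I \<subseteq> {1..n}" and "j \<in> I"
  shows "card {i\<in>{1..<j}. i \<in> I} < card I"
  using rank_bij[OF assms(1)] assms(2) by (auto simp: bij_betw_def)

text \<open>The second list is read by rank in the complement of \<open>I\<close>, which may be
  infinite; cutting it to \<open>{1..n}\<close> makes the rank lemmas applicable.\<close>

lemma rank_compl:
  "j \<le> (n::nat) \<Longrightarrow> {i\<in>{1..<j}. i \<notin> I} = {i\<in>{1..<j}. i \<in> {1..n} - I}"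
  by auto

lemma length_weave [simp]: "length (weave I as bs) = length as + length bs"
  by (simp add: weave_def del: upt_Suc)

lemma weave_nth:
  assumes "i < length as + length bs"
  shows "weave I as bs ! i = (if Suc i \<in> I then as ! card {j\<in>{1..<Suc i}. j \<in> I}
    else bs ! card {j\<in>{1..<Suc i}. j \<notin> I})"
  using assms unfolding weave_def by (subst nth_map) (auto simp del: upt_Suc)

lemma weave_nth_cases:
  assumes "I \<subseteq> {1..length as + length bs}" and "card I = length as" and "i < length as + length bs"
  obtains (left) "Suc i \<in> I" "card {j\<in>{1..<Suc i}. j \<in> I} < length as"
      "weave I as bs ! i = as ! card {j\<in>{1..<Suc i}. j \<in> I}"
  | (right) "Suc i \<notin> I" "card {j\<in>{1..<Suc i}. j \<notin> I} < length bs"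
      "weave I as bs ! i = bs ! card {j\<in>{1..<Suc i}. j \<notin> I}"
proof (cases "Suc i \<in> I")
  case True
  then show ?thesis
    using left rank_less[OF assms(1) True] weave_nth[OF assms(3)] assms(2) by simp
next
  case False
  let ?J = "{1..length as + length bs} - I"
  have "card ?J = length bs"
    using assms(1,2) by (simp add: card_Diff_subset finite_subset)
  moreover have "Suc i \<in> ?J"
    using False assms(3) by auto
  ultimately have "card {j\<in>{1..<Suc i}. j \<notin> I} < length bs"
    using rank_less[of ?J "length as + length bs" "Suc i"]
      rank_compl[of "Suc i" "length as + length bs" I] assms(3) by auto
  with False right weave_nth[OF assms(3), of I] show ?thesis by simp
qed

lemma set_weave:
  assumes "I \<subseteq> {1..length as + length bs}" and "card I = length as"
  shows "set (weave I as bs) \<subseteq> set as \<union> set bs"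
proof
  fix x assume "x \<in> set (weave I as bs)"
  then obtain i where i: "i < length as + length bs" "x = weave I as bs ! i"
    by (auto simp: in_set_conv_nth)
  then show "x \<in> set as \<union> set bs"
    using assms by (cases rule: weave_nth_cases[OF assms i(1)]) auto
qed

lemma map_weave:
  assumes "I \<subseteq> {1..length as + length bs}" and "card I = length as"
  shows "map f (weave I as bs) = weave I (map f as) (map f bs)"
proof (rule nth_equalityI)
  fix i assume "i < length (map f (weave I as bs))"
  then have i: "i < length as + length bs" by simp
  show "map f (weave I as bs) ! i = weave I (map f as) (map f bs) ! i"
    using i by (cases rule: weave_nth_cases[OF assms i]) (auto simp: weave_nth)
qed simp

text \<open>The two parts are read off through the inverse rank bijections. The descriptions of
  their entry sets later show which part lies below which child.\<close>

lemma weave_surj: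
  assumes "I \<subseteq> {1..length es}"
  obtains as bs where "es = weave I as bs" "length as = card I" "length as + length bs = length es"
    "set as = {es ! i | i. Suc i \<in> I}" "set bs = {es ! i | i. i < length es \<and> Suc i \<notin> I}"
proof -
  let ?n = "length es"
  let ?J = "{1..?n} - I"
  let ?rI = "\<lambda>j. card {i\<in>{1..<j}. i \<in> I}" and ?rJ = "\<lambda>j. card {i\<in>{1..<j}. i \<in> ?J}"
  define as where "as = map (\<lambda>r. es ! (inv_into I ?rI r - 1)) [0..<card I]"
  define bs where "bs = map (\<lambda>r. es ! (inv_into ?J ?rJ r - 1)) [0..<card ?J]"
  have bI: "bij_betw ?rI I {..<card I}" and bJ: "bij_betw ?rJ ?J {..<card ?J}"
    by (rule rank_bij[OF assms], rule rank_bij[of ?J ?n]) blast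
  have len: "length as + length bs = ?n"
    using assms card_mono[OF _ assms] by (simp add: as_def bs_def card_Diff_subset finite_subset)
  have "es = weave I as bs"
  proof (rule nth_equalityI)
    fix i assume i: "i < length es"
    show "es ! i = weave I as bs ! i"
    proof (cases "Suc i \<in> I")
      case True
      then have "?rI (Suc i) < card I" "inv_into I ?rI (?rI (Suc i)) = Suc i"
        using rank_less[OF assms True] bij_betw_inv_into_left[OF bI True] by blast+
      with True i len show ?thesis by (simp add: weave_nth as_def)
    next
      case False
      with i have J: "Suc i \<in> ?J" by auto
      then have "?rJ (Suc i) < card ?J" "inv_into ?J ?rJ (?rJ (Suc i)) = Suc i"
        using rank_less[of ?J ?n "Suc i"] bij_betw_inv_into_left[OF bJ J] by blast+
      with False i len show ?thesis
        using rank_compl[of "Suc i" ?n I] by (simp add: weave_nth bs_def)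
    qed
  qed (simp add: len)
  moreover have "set as = {es ! i | i. Suc i \<in> I}"
  proof -
    have "set as = (\<lambda>j. es ! (j - 1)) ` inv_into I ?rI ` {..<card I}"
      by (simp add: as_def image_image atLeast0LessThan)
    also have "inv_into I ?rI ` {..<card I} = I"
      using bij_betw_inv_into[OF bI] by (simp add: bij_betw_def)
    also have "(\<lambda>j. es ! (j - 1)) ` I = {es ! i | i. Suc i \<in> I}"
    proof -
      have "\<exists>i. es ! (j - 1) = es ! i \<and> Suc i \<in> I" if "j \<in> I" for j
        using that assms by (intro exI[of _ "j - 1"]) auto
      then show ?thesis by (force simp: image_iff)
    qed
    finally show ?thesis .
  qed
  moreover have "set bs = {es ! i | i. i < length es \<and> Suc i \<notin> I}"
  proof -
    have "set bs = (\<lambda>j. es ! (j - 1)) ` inv_into ?J ?rJ ` {..<card ?J}"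
      by (simp add: bs_def image_image atLeast0LessThan)
    also have "inv_into ?J ?rJ ` {..<card ?J} = ?J"
      using bij_betw_inv_into[OF bJ] by (simp add: bij_betw_def)
    also have "(\<lambda>j. es ! (j - 1)) ` ?J = {es ! i | i. i < length es \<and> Suc i \<notin> I}"
    proof -
      have "\<exists>i. es ! (j - 1) = es ! i \<and> i < length es \<and> Suc i \<notin> I" if "j \<in> ?J" for j
        using that by (intro exI[of _ "j - 1"]) auto
      then show ?thesis by (force simp: image_iff)
    qed
    finally show ?thesis .
  qed
  moreover have "length as = card I" by (simp add: as_def)
  ultimately show ?thesis using that len by blast
qed

text \<open>Every rank is attained, so comparing the woven tuples at the corresponding positions
  recovers each entry of both lists.\<close>

lemma weave_eqD:
  assumes "I \<subseteq> {1..length as + length bs}" and "card I = length as"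
    and "length as' = length as" and "length bs' = length bs"
    and eq: "weave I as bs = weave I as' bs'"
  shows "as = as'" and "bs = bs'"
proof -
  let ?n = "length as + length bs"
  let ?J = "{1..?n} - I"
  have cJ: "card ?J = length bs"
    using assms(1,2) by (simp add: card_Diff_subset finite_subset)
  show "as = as'"
  proof (rule nth_equalityI)
    fix r assume "r < length as"
    then obtain j where j: "j \<in> I" "r = card {i\<in>{1..<j}. i \<in> I}"
      using rank_bij[OF assms(1)] assms(2) by (auto simp: bij_betw_def set_eq_iff image_iff)
    then obtain i where "j = Suc i" "i < ?n"
      using assms(1) by (cases j) auto
    then show "as ! r = as' ! r"
      using arg_cong[OF eq, of "\<lambda>l. l ! i"] j assms(3,4) by (simp add: weave_nth)
  qed (simp add: assms)
  show "bs = bs'"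
  proof (rule nth_equalityI)
    fix r assume "r < length bs"
    then obtain j where j: "j \<in> ?J" "r = card {i\<in>{1..<j}. i \<in> ?J}"
      using bij_betw_imp_surj_on[OF rank_bij[of ?J ?n]] cJ by (metis (no_types, lifting) Diff_subset image_iff lessThan_iff)
    then obtain i where i: "j = Suc i" "i < ?n"
      by (cases j) auto
    then have "r = card {l\<in>{1..<Suc i}. l \<notin> I}"
      using j rank_compl[of j ?n I] by simp
    with i j show "bs ! r = bs' ! r"
      using arg_cong[OF eq, of "\<lambda>l. l ! i"] assms(3,4) by (simp add: weave_nth)
  qed (simp add: assms)
qed

text \<open>The split happens on indices and not on terms, so the same \<open>is1\<close> and
  \<open>is2\<close> work for every \<open>g\<close>. This allows the terms of a subtree to be
  exchanged while the instruction stays the same.\<close>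

lemma weave_split:
  assumes f: "map f is = weave I as bs" and I: "I \<subseteq> {1..length as + length bs}" "card I = length as"
  obtains is1 is2 where "as = map f is1" "bs = map f is2" "set is1 \<subseteq> set is" "set is2 \<subseteq> set is"
    "\<And>g. map g is = weave I (map g is1) (map g is2)"
proof -
  have len: "length is = length as + length bs"
    using arg_cong[OF f, of length] by simp
  from I len have "I \<subseteq> {1..length is}" by simp
  then obtain is1 is2 where w: "is = weave I is1 is2" "length is1 = card I"
      "length is1 + length is2 = length is"
      "set is1 = {is ! i | i. Suc i \<in> I}" "set is2 = {is ! i | i. i < length is \<and> Suc i \<notin> I}"
    by (rule weave_surj)
  have I': "I \<subseteq> {1..length is1 + length is2}" "card I = length is1"
    using I w len by auto
  have g: "map g is = weave I (map g is1) (map g is2)" for g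
    unfolding w(1) by (rule map_weave[OF I'])
  have "as = map f is1" "bs = map f is2"
    using weave_eqD[OF I, of "map f is1" "map f is2"] f g[of f] w(2,3) len I by auto
  moreover have "i < length is" if "Suc i \<in> I" for i
    using that I(1) len by auto
  then have "set is1 \<subseteq> set is" "set is2 \<subseteq> set is"
    unfolding w(4,5) by auto
  ultimately show ?thesis
    using that g by blast
qed

section \<open>From colors to bounded index\<close>

locale decorated_tree =
  fixes S :: "('r, 'c) sig" and L :: palette and T :: "node \<Rightarrow> ('r, 'c) decorator set"
  assumes pal: "palette_for S L" and wd: "well_decorated S L T"
begin

primrec leaf_of :: "('c, node) trm \<Rightarrow> node \<Rightarrow> bool" where
  "leaf_of (Cst c) s \<longleftrightarrow> DCst c \<in> T s"
| "leaf_of (Null u) s \<longleftrightarrow> u = s \<and> DStar \<in> T s"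

definition ents :: "node \<Rightarrow> ('c, node) trm set" where
  "ents s = {t. \<exists>s'. prefix s s' \<and> leaf_of t s'}"

lemma leaf_of_pseudoleaf: "leaf_of t s \<Longrightarrow> pseudoleaf T s"
  by (cases t) (auto simp: pseudoleaf_def)

lemma leaf_of_unique: "leaf_of t s \<Longrightarrow> leaf_of t s' \<Longrightarrow> s = s'"
  using wd by (cases t) (auto simp: well_decorated_def)

lemma below_pseudoleaf:
  assumes "pseudoleaf T s" and "leaf_of t s'" and "prefix s s'"
  shows "s' = s"
proof -
  obtain r where r: "s' = s @ r"
    using assms(3) by (auto simp: prefix_def)
  have "T s' \<noteq> {}"
    using assms(2) by (cases t) auto
  then show ?thesis
    using wd assms(1) r unfolding well_decorated_def by auto
qed

lemma leaf_of_antichain: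
  assumes "leaf_of t s" and "leaf_of u s'" and "prefix s s'"
  shows "t = u"
proof -
  have eq: "s' = s"
    using below_pseudoleaf[OF leaf_of_pseudoleaf] assms by blast
  have "\<forall>c. DCst c \<in> T s \<longrightarrow> T s = {DCst c}" "DStar \<in> T s \<longrightarrow> T s = {DStar}"
    using wd unfolding well_decorated_def by simp_all
  then show ?thesis
    using assms eq by (cases t; cases u) auto
qed

lemma ents_mono: "prefix s s' \<Longrightarrow> ents s' \<subseteq> ents s"
  unfolding ents_def by (blast intro: prefix_order.trans)

lemma ents_disjoint:
  assumes "\<not> prefix s s'" and "\<not> prefix s' s"
  shows "ents s \<inter> ents s' = {}"
  using assms prefix_same_cases leaf_of_unique unfolding ents_def by blast

lemma ents_below_pseudoleaf: "pseudoleaf T u \<Longrightarrow> strict_prefix u s \<Longrightarrow> ents s = {}"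
  using below_pseudoleaf[of u] unfolding ents_def by (fastforce simp: strict_prefix_def prefix_def)

lemma decorator_ok: "d \<in> T s \<Longrightarrow> decorator_over S L d"
  using wd by (auto simp: well_decorated_def)

lemma in_col_sound:
  assumes "in_col S L T s \<kappa> es"
  shows "\<kappa> \<in> colors L \<and> length es = car L \<kappa> \<and> set es \<subseteq> ents s"
  using assms
proof induction
  case (leaf_cst c s i)
  then have "leaf_of (Cst c) s" by simp
  with leaf_cst pal show ?case
    unfolding ents_def palette_for_def by (auto intro: prefix_order.order_refl)
next
  case (leaf_star s i)
  then have "leaf_of (Null s) s" by simp
  with leaf_star pal show ?case
    unfolding ents_def palette_for_def by (auto intro: prefix_order.order_refl)
next
  case (add s \<kappa> \<mu> I \<nu> as bs)
  from decorator_ok[OF add(2)] add.IH have "I \<subseteq> {1..length as + length bs}" "card I = length as"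
    by auto
  from set_weave[OF this] have "set (weave I as bs) \<subseteq> ents s"
    using add.IH ents_mono[of s "s @ [False]"] ents_mono[of s "s @ [True]"] by fastforce
  with decorator_ok[OF add(2)] add.IH show ?case by simp
next
  case (recol s i \<kappa> \<nu> as)
  then show ?case
    using decorator_ok[OF recol(2)] ents_mono[of s "s @ [i]"] by auto
next
  case (keep s i \<nu> as)
  then show ?case
    using ents_mono[of s "s @ [i]"] by auto
qed

text \<open>Seen from above, the terms below \<open>s\<close> matter only through the colors of
  their tuples at \<open>s\<close>. Nodes strictly below \<open>s\<close> are excluded, since the
  colors at \<open>s\<close> do not determine those further down.\<close>

lemma in_col_subst:
  assumes a: "\<forall>i\<in>P. a i \<in> ents s"
    and types: "\<And>js \<kappa>. set js \<subseteq> P \<Longrightarrow> in_col S L T s \<kappa> (map a js) \<Longrightarrow> in_col S L T s \<kappa> (map a' js)"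
    and "in_col S L T u \<kappa> (map (override_on b a P) is)"
    and "\<forall>i\<in>set is - P. b i \<notin> ents s" and "\<not> strict_prefix s u"
  shows "in_col S L T u \<kappa> (map (override_on b a' P) is)"
proof (cases "prefix u s")
  case True
  then obtain r where "s = u @ r" by (auto simp: prefix_def)
  then show ?thesis
    using assms(3-5)
  proof (induction r arbitrary: u \<kappa> "is")
    \<comment> \<open>At \<open>s\<close> itself every entry is an entity of \<open>s\<close>, so no
      index can refer to \<open>b\<close>, and \<open>types\<close> applies to the whole
      tuple.\<close>
    case Nil
    have in_ents: "override_on b a P i \<in> ents s" if "i \<in> set is" for i
      using in_col_sound[OF Nil(2)] Nil(1) that by auto
    have P: "i \<in> P" if "i \<in> set is" for i
      using in_ents[OF that] Nil(3) that by (cases "i \<in> P") auto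
    then have "map (override_on b a P) is = map a is" "map (override_on b a' P) is = map a' is"
      by auto
    with Nil types[of "is"] P show ?case by (simp only: append_Nil2) blast
  next
    case (Cons i r)
    let ?f = "override_on b a P" and ?f' = "override_on b a' P"
    \<comment> \<open>On the branch towards \<open>s\<close> the induction hypothesis applies. The
      other branch holds no entity of \<open>s\<close>, so its tuples use no index of
      \<open>P\<close> and stay unchanged.\<close>
    have child: "in_col S L T (u @ [j]) \<kappa> (map ?f' js)"
      if "in_col S L T (u @ [j]) \<kappa> (map ?f js)" "set js \<subseteq> set is" for j \<kappa> js
    proof (cases "j = i")
      case True
      with that Cons show ?thesis
        by (intro Cons.IH) (auto simp: strict_prefix_def)
    next
      case False
      have "ents (u @ [j]) \<inter> ents s = {}"
        by (rule ents_disjoint) (use False Cons.prems(1) in auto)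
      then have "x \<notin> P" if "x \<in> set js" for x
        using in_col_sound[OF \<open>in_col S L T (u @ [j]) \<kappa> (map ?f js)\<close>] that a
        by (metis disjoint_iff image_subset_iff list.set_map override_on_apply_in)
      then have eq: "map ?f' js = map ?f js" by auto
      show ?thesis unfolding eq by (rule that(1))
    qed
    from Cons.prems(2) show ?case
    proof (cases rule: in_col.cases)
      case (leaf_cst c k)
      \<comment> \<open>A pseudoleaf properly above \<open>s\<close> leaves \<open>s\<close> without
        entities, so \<open>P\<close> is empty and nothing is exchanged.\<close>
      then have "ents s = {}"
        using Cons.prems(1) by (intro ents_below_pseudoleaf[of u]) (auto simp: pseudoleaf_def strict_prefix_def)
      with a have "P = {}" by auto
      with Cons.prems(2) show ?thesis by simp
    next
      case (leaf_star k)
      then have "ents s = {}"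
        using Cons.prems(1) by (intro ents_below_pseudoleaf[of u]) (auto simp: pseudoleaf_def strict_prefix_def)
      with a have "P = {}" by auto
      with Cons.prems(2) show ?thesis by simp
    next
      case (add \<kappa>' \<mu> I as bs)
      have I: "I \<subseteq> {1..length as + length bs}" "card I = length as"
        using decorator_ok[OF add(3)] in_col_sound[OF add(4)] in_col_sound[OF add(5)] by auto
      obtain is1 is2 where w: "as = map ?f is1" "bs = map ?f is2" "set is1 \<subseteq> set is"
          "set is2 \<subseteq> set is" "\<And>g :: _ \<Rightarrow> ('c, node) trm. map g is = weave I (map g is1) (map g is2)"
        using weave_split[OF add(1) I] by metis
      show ?thesis
        unfolding w(5)[of ?f'] using child[OF _ w(3)] child[OF _ w(4)] add(4,5) w(1,2)
        by (intro in_col.add[OF add(2,3)]) simp_all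
    next
      case (recol j \<kappa>')
      show ?thesis by (rule in_col.recol[OF recol(1,2) child[OF recol(3)]]) simp
    next
      case (keep j)
      show ?thesis by (rule in_col.keep[OF keep(1,2) child[OF keep(3)]]) simp
    qed
  qed
next
  case False
  then have "ents u \<inter> ents s = {}"
    using assms(5) by (intro ents_disjoint) (auto simp: strict_prefix_def)
  then have "x \<notin> P" if "x \<in> set is" for x
    using in_col_sound[OF assms(3)] that a
    by (metis disjoint_iff image_subset_iff list.set_map override_on_apply_in)
  then have eq: "map (override_on b a' P) is = map (override_on b a P) is" by auto
  show ?thesis unfolding eq by (rule assms(3))
qed

lemma atoms_at_RAdd:
  assumes "\<not> pseudoleaf T s" and "RAdd \<kappa> \<mu> I R \<in> T s"
    and "in_col S L T (s @ [False]) \<kappa> as" and "in_col S L T (s @ [True]) \<mu> bs"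
  shows "Atom R (weave I as bs) \<in> atoms_at S L T s"
proof -
  have "\<exists>\<kappa> \<mu>. RAdd \<kappa> \<mu> I R \<in> T s
      \<and> in_col S L T (s @ [False]) \<kappa> as \<and> in_col S L T (s @ [True]) \<mu> bs"
    using assms by blast
  with assms(1) show ?thesis
    unfolding atoms_at_def by auto
qed

lemma atoms_at_ents:
  assumes "Atom R ts \<in> atoms_at S L T u"
  shows "set ts \<subseteq> ents u"
proof (cases "pseudoleaf T u")
  case True
  with assms show ?thesis
    by (auto simp: atoms_at_def ents_def split: if_splits)
next
  case False
  with assms consider (radd) \<kappa> \<mu> I as bs where "ts = weave I as bs" "RAdd \<kappa> \<mu> I R \<in> T u"
      "in_col S L T (u @ [False]) \<kappa> as" "in_col S L T (u @ [True]) \<mu> bs"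
    | (mat) i \<kappa> where "in_col S L T (u @ [i]) \<kappa> ts"
    by (auto simp: atoms_at_def)
  then show ?thesis
  proof cases
    case radd
    then have "I \<subseteq> {1..length as + length bs}" "card I = length as"
      using decorator_ok[OF radd(2)] in_col_sound[OF radd(3)] in_col_sound[OF radd(4)] by auto
    moreover have "set as \<subseteq> ents u" "set bs \<subseteq> ents u"
      using in_col_sound[OF radd(3)] in_col_sound[OF radd(4)]
        ents_mono[of u "u @ [False]"] ents_mono[of u "u @ [True]"] by auto
    ultimately show ?thesis
      using set_weave radd(1) by blast
  next
    case mat
    with in_col_sound[OF mat] ents_mono[of u "u @ [i]"] show ?thesis by auto
  qed
qed

lemma Top_represented: "t \<in> ents [] \<Longrightarrow> Atom (Top S) [t] \<in> represented S L T"
proof -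
  assume "t \<in> ents []"
  then obtain s where s: "leaf_of t s" by (auto simp: ents_def)
  then have "Atom (Top S) [t] \<in> atoms_at S L T s"
    using leaf_of_pseudoleaf[OF s] by (cases t) (auto simp: atoms_at_def)
  then show ?thesis by (auto simp: represented_def)
qed

lemma adom_represented: "adom (represented S L T) = ents []"
proof
  show "adom (represented S L T) \<subseteq> ents []"
  proof
    fix t assume "t \<in> adom (represented S L T)"
    then obtain \<alpha> u where \<alpha>: "\<alpha> \<in> atoms_at S L T u" "t \<in> atom_terms \<alpha>"
      by (auto simp: adom_def represented_def)
    then obtain R ts where "\<alpha> = Atom R ts" by (cases \<alpha>)
    with \<alpha> atoms_at_ents[of R ts u] ents_mono[of "[]" u] show "t \<in> ents []" by auto
  qed
  show "ents [] \<subseteq> adom (represented S L T)"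
    using Top_represented by (force simp: adom_def)
qed

text \<open>An atom with entries on both sides of \<open>s\<close> is created at a proper ancestor
  of \<open>s\<close>, whose children are never strictly below \<open>s\<close>;
  \<open>in_col_subst\<close> therefore applies to the tuples it is built from. Atoms entirely below
  \<open>s\<close> escape this argument, hence the assumption \<open>mixed\<close>.\<close>

lemma represented_subst:
  assumes a: "\<forall>i\<in>P. a i \<in> ents s"
    and types: "\<And>js \<kappa>. set js \<subseteq> P \<Longrightarrow> in_col S L T s \<kappa> (map a js) \<Longrightarrow> in_col S L T s \<kappa> (map a' js)"
    and atom: "Atom R (map (override_on b a P) is) \<in> represented S L T"
    and b: "\<forall>i\<in>set is - P. b i \<notin> ents s"
    and mixed: "i0 \<in> set is - P" "i1 \<in> set is \<inter> P"
  shows "Atom R (map (override_on b a' P) is) \<in> represented S L T"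
proof -
  let ?f = "override_on b a P" and ?f' = "override_on b a' P"
  obtain u where u: "Atom R (map ?f is) \<in> atoms_at S L T u"
    using atom by (auto simp: represented_def)
  from atoms_at_ents[OF u] have sub: "?f i \<in> ents u" if "i \<in> set is" for i
    using that by auto
  have 0: "b i0 \<in> ents u" "b i0 \<notin> ents s" and 1: "a i1 \<in> ents u" "a i1 \<in> ents s"
    using sub[of i0] sub[of i1] mixed b a by auto
  have "\<not> prefix s u"
    using 0 ents_mono by blast
  with ents_disjoint 1 have "prefix u s" "u \<noteq> s" by auto
  then have u_s: "strict_prefix u s" by (simp add: strict_prefix_def)
  have npl: "\<not> pseudoleaf T u"
    using ents_below_pseudoleaf[OF _ u_s] 1 by auto
  have child: "in_col S L T (u @ [j]) \<kappa> (map ?f' js)"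
    if "in_col S L T (u @ [j]) \<kappa> (map ?f js)" "set js \<subseteq> set is" for j \<kappa> js
  proof (rule in_col_subst[OF a types that(1)])
    show "\<forall>i\<in>set js - P. b i \<notin> ents s"
      using b that(2) by auto
    show "\<not> strict_prefix s (u @ [j])"
      using \<open>\<not> prefix s u\<close> by (auto simp: strict_prefix_def)
  qed
  from u npl consider (radd) \<kappa> \<mu> I as bs where "map ?f is = weave I as bs" "RAdd \<kappa> \<mu> I R \<in> T u"
      "in_col S L T (u @ [False]) \<kappa> as" "in_col S L T (u @ [True]) \<mu> bs"
    | (mat) i \<kappa> where "Mat i \<kappa> R \<in> T u" "in_col S L T (u @ [i]) \<kappa> (map ?f is)"
    by (auto simp: atoms_at_def)
  then have "Atom R (map ?f' is) \<in> atoms_at S L T u"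
  proof cases
    case radd
    then have I: "I \<subseteq> {1..length as + length bs}" "card I = length as"
      using decorator_ok[OF radd(2)] in_col_sound[OF radd(3)] in_col_sound[OF radd(4)] by auto
    obtain is1 is2 where w: "as = map ?f is1" "bs = map ?f is2" "set is1 \<subseteq> set is"
        "set is2 \<subseteq> set is" "\<And>g :: _ \<Rightarrow> ('c, node) trm. map g is = weave I (map g is1) (map g is2)"
      using weave_split[OF radd(1) I] by metis
    have "in_col S L T (u @ [False]) \<kappa> (map ?f' is1)" "in_col S L T (u @ [True]) \<mu> (map ?f' is2)"
      using radd w child by auto
    then show ?thesis
      unfolding w(5)[of ?f'] by (rule atoms_at_RAdd[OF npl radd(2)])
  next
    case mat
    from child[OF mat(2)] have "in_col S L T (u @ [i]) \<kappa> (map ?f' is)" by simp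
    with mat(1) npl show ?thesis
      unfolding atoms_at_def by auto
  qed
  then show ?thesis by (auto simp: represented_def)
qed

text \<open>The type \<open>g a\<close> records which lists of inside positions have which colors at
  \<open>s\<close>, and settles the atoms with entries on both sides. One more bit, the truth value
  of the atom on \<open>a\<close>, settles those whose arguments are all inside.\<close>

lemma bounded_instance_represented: "bounded_instance S (range ents) (represented S L T)"
  unfolding bounded_instance_def
proof
  fix R assume "R \<in> rels S"
  let ?n = "ar S R" and ?rep = "represented S L T"
  let ?\<rho> = "\<lambda>v. Atom R (map v [0..<?n]) \<in> ?rep"
  \<comment> \<open>Lists longer than every color arity never have a color, so finitely many pairs
    cover all types. Neither \<open>G\<close> nor its size depends on the node.\<close>
  define G where "G = {js. set js \<subseteq> {..<?n} \<and> length js \<le> Max (car L ` colors L)} \<times> colors L"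
  have finc: "finite (colors L)"
    using pal by (simp add: palette_for_def)
  then have fin: "finite G"
    unfolding G_def by (simp add: finite_lists_length_le)
  show "bounded_index (range ents) {..<?n} ?\<rho>"
  proof (rule bounded_indexI)
    fix V :: "nat set" and X assume "X \<in> range ents"
    then obtain s where X: "X = ents s" by blast
    let ?A = "{v. \<forall>x\<in>V. v x \<in> X}" and ?P = "V \<inter> {..<?n}"
    define g where "g a = {(js, \<kappa>). set js \<subseteq> ?P \<and> in_col S L T s \<kappa> (map a js)}" for a
    have "few (2 ^ card G) g ?A"
    proof (rule few_subset[where B = "Pow G"])
      have "length js \<le> Max (car L ` colors L)" if "in_col S L T s \<kappa> (map a js)" for a js \<kappa>
        using in_col_sound[OF that] finc by auto
      then show "g ` ?A \<subseteq> Pow G"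
        using in_col_sound by (fastforce simp: g_def G_def)
    qed (use fin in \<open>auto simp: card_Pow\<close>)
    moreover have "few 2 ?\<rho> ?A"
      by (rule few_two[where c = True and d = False]) auto
    ultimately have "few (2 ^ card G * 2) (\<lambda>a. (g a, ?\<rho> a)) ?A"
      by (rule few_Pair)
    then show "few (2 ^ card G * 2) (out_profile {..<?n} ?\<rho> V X) ?A"
    proof (rule few_determined)
      have sub: "out_profile {..<?n} ?\<rho> V X a \<subseteq> out_profile {..<?n} ?\<rho> V X a'"
        if aa: "a \<in> ?A" "(g a, ?\<rho> a) = (g a', ?\<rho> a')" for a a'
      proof
        fix w assume "w \<in> out_profile {..<?n} ?\<rho> V X a"
        then have w: "\<forall>x\<in>{..<?n} - V. w x \<notin> X" "?\<rho> (override_on w a V)"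
          by (auto simp: out_profile_def)
        have P: "map (override_on w c V) [0..<?n] = map (override_on w c ?P) [0..<?n]" for c
          by (auto simp: override_on_def)
        have "?\<rho> (override_on w a' V)"
        proof (cases "{..<?n} \<subseteq> V")
          case True
          then have "map (override_on w c V) [0..<?n] = map c [0..<?n]" for c
            by auto
          with w(2) aa(2) show ?thesis by (metis (no_types, lifting) Pair_inject)
        next
          case False
          then obtain i0 where i0: "i0 \<in> set [0..<?n] - ?P" by auto
          show ?thesis
          proof (cases "?P = {}")
            case True
            with w show ?thesis unfolding P by simp
          next
            case False
            then obtain i1 where i1: "i1 \<in> set [0..<?n] \<inter> ?P" by auto
            show ?thesis
              unfolding P
            proof (rule represented_subst[OF _ _ _ _ i0 i1])
              show "\<forall>i\<in>?P. a i \<in> ents s"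
                using aa X by auto
              show "in_col S L T s \<kappa> (map a' js)"
                if "set js \<subseteq> ?P" "in_col S L T s \<kappa> (map a js)" for js \<kappa>
              proof -
                from that have "(js, \<kappa>) \<in> g a" by (simp add: g_def)
                with aa have "(js, \<kappa>) \<in> g a'" by simp
                then show ?thesis by (simp add: g_def)
              qed
            qed (use w X P in auto)
          qed
        qed
        with w show "w \<in> out_profile {..<?n} ?\<rho> V X a'"
          by (simp add: out_profile_def)
      qed
      fix a a' assume "a \<in> ?A" "a' \<in> ?A" "(g a, ?\<rho> a) = (g a', ?\<rho> a')"
      with sub[of a a'] sub[of a' a]
      show "out_profile {..<?n} ?\<rho> V X a = out_profile {..<?n} ?\<rho> V X a'"
        by (metis (no_types, lifting) subset_antisym)
    qed
  qed
qed

end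

section \<open>Transfer of addresses to an arbitrary instance of finite partitionwidth\<close>

definition below :: "'t set \<Rightarrow> ('t \<Rightarrow> node) \<Rightarrow> node \<Rightarrow> 't set" where
  "below D adr s = {t\<in>D. prefix s (adr t)}"

text \<open>The infimum of the empty set is infinite, and a single admissible palette already bounds
  it by a natural number.\<close>

lemma finite_partitionwidth_iff:
  "finite_partitionwidth S I \<longleftrightarrow>
    (\<exists>L T. palette_for S L \<and> well_decorated S L T \<and> isomorphic I (represented S L T))"
proof -
  let ?A = "{L. palette_for S L \<and> (\<exists>T. well_decorated S L T \<and> isomorphic I (represented S L T))}"
  have "finite_partitionwidth S I \<longleftrightarrow> ?A \<noteq> {}"
  proof
    assume "finite_partitionwidth S I"
    then show "?A \<noteq> {}"
      by (force simp: finite_partitionwidth_def partitionwidth_def top_enat_def simp del: Collect_empty_eq)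
  next
    assume "?A \<noteq> {}"
    then obtain L where "L \<in> ?A" by blast
    then have "partitionwidth S I \<le> enat (card (colors L))"
      unfolding partitionwidth_def by (rule INF_lower)
    then show "finite_partitionwidth S I"
      unfolding finite_partitionwidth_def using enat_ile by blast
  qed
  then show ?thesis by auto
qed

text \<open>Each term inherits the node of the pseudoleaf that carries its image, and profiles are
  pulled back along the isomorphism. The \<open>Top\<close> atoms are recorded because every
  pseudoleaf of the tree built later emits one.\<close>

theorem finite_partitionwidth_addresses:
  fixes I :: "('r, ('c, 'n) trm) atom set"
  assumes "finite_partitionwidth S I"
  obtains adr where "\<And>t u. t \<in> adom I \<Longrightarrow> u \<in> adom I \<Longrightarrow> prefix (adr t) (adr u) \<Longrightarrow> t = u"
    and "\<And>t. t \<in> adom I \<Longrightarrow> Atom (Top S) [t] \<in> I"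
    and "bounded_instance S (range (below (adom I) adr)) I"
proof -
  obtain L T where LT: "palette_for S L" "well_decorated S L T" "isomorphic I (represented S L T)"
    using assms finite_partitionwidth_iff by blast
  interpret decorated_tree S L T
    using LT by unfold_locales
  let ?rep = "represented S L T"
  obtain f where f: "bij_betw f (adom I) (adom ?rep)"
      "(\<lambda>\<alpha>. case \<alpha> of Atom R ts \<Rightarrow> Atom R (map f ts)) ` I = ?rep"
    using LT(3) unfolding isomorphic_def by blast
  have inj: "inj_on f (adom I)" and img: "f ` adom I = ents []"
    using f(1) adom_represented by (auto simp: bij_betw_def)
  have terms: "set ts \<subseteq> adom I" if "Atom R ts \<in> I" for R ts
    using that by (force simp: adom_def)
  have fwd: "Atom R (map f ts) \<in> ?rep" if "Atom R ts \<in> I" for R ts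
    using that f(2) by force
  have bwd: "Atom R ts \<in> I" if rep: "Atom R (map f ts) \<in> ?rep" and sub: "set ts \<subseteq> adom I" for R ts
  proof -
    obtain us where us: "Atom R us \<in> I" "map f us = map f ts"
    proof -
      from rep have "Atom R (map f ts) \<in> (\<lambda>\<alpha>. case \<alpha> of Atom R ts \<Rightarrow> Atom R (map f ts)) ` I"
        using f(2) by simp
      then show ?thesis using that by (auto split: atom.splits)
    qed
    have "us = ts"
      using us(2) terms[OF us(1)] sub by (intro map_inj_on[of f]) (auto intro: inj_on_subset[OF inj])
    with us show ?thesis by simp
  qed
  define adr where "adr t = (THE s. leaf_of (f t) s)" for t
  have adr: "leaf_of (f t) (adr t)" if "t \<in> adom I" for t
  proof -
    have "f t \<in> ents []" using img that by blast
    then have "\<exists>!s. leaf_of (f t) s"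
      using leaf_of_unique by (auto simp: ents_def)
    then show ?thesis unfolding adr_def by (rule theI')
  qed
  have below: "below (adom I) adr s = {t\<in>adom I. f t \<in> ents s}" for s
    using adr leaf_of_unique unfolding below_def ents_def by blast
  show ?thesis
  proof (rule that)
    show "t = u" if "t \<in> adom I" "u \<in> adom I" "prefix (adr t) (adr u)" for t u
      using leaf_of_antichain[OF adr[OF that(1)] adr[OF that(2)] that(3)] inj that
      by (auto dest: inj_onD)
    show "Atom (Top S) [t] \<in> I" if "t \<in> adom I" for t
      using bwd[of "Top S" "[t]"] Top_represented[of "f t"] img that by auto
    show "bounded_instance S (range (below (adom I) adr)) I"
      unfolding bounded_instance_def
    proof
      fix R assume R: "R \<in> rels S"
      let ?n = "ar S R"
      let ?\<rho> = "\<lambda>v. Atom R (map v [0..<?n]) \<in> I" and ?\<rho>' = "\<lambda>v. Atom R (map v [0..<?n]) \<in> ?rep"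
      obtain N where N: "\<And>V X. X \<in> range ents \<Longrightarrow>
          few N (out_profile {..<?n} ?\<rho>' V X) {v. \<forall>x\<in>V. v x \<in> X}"
        using bounded_instance_represented R unfolding bounded_instance_def bounded_index_def by blast
      show "bounded_index (range (below (adom I) adr)) {..<?n} ?\<rho>"
      proof (rule bounded_indexI)
        fix V :: "nat set" and X assume "X \<in> range (below (adom I) adr)"
        then obtain s where X: "X = {t\<in>adom I. f t \<in> ents s}"
          using below by auto
        let ?A = "{v. \<forall>x\<in>V. v x \<in> X}"
        have "few N (\<lambda>a. out_profile {..<?n} ?\<rho>' V (ents s) (f \<circ> a)) ?A"
          by (rule few_reindex[OF N]) (auto simp: X)
        then show "few N (out_profile {..<?n} ?\<rho> V X) ?A"
        proof (rule few_determined)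
          have sub: "out_profile {..<?n} ?\<rho> V X a \<subseteq> out_profile {..<?n} ?\<rho> V X a'"
            if aa: "a' \<in> ?A" "out_profile {..<?n} ?\<rho>' V (ents s) (f \<circ> a)
                = out_profile {..<?n} ?\<rho>' V (ents s) (f \<circ> a')" for a a'
          proof
            fix w assume "w \<in> out_profile {..<?n} ?\<rho> V X a"
            then have w: "\<forall>x\<in>{..<?n} - V. w x \<notin> X" "?\<rho> (override_on w a V)"
              by (auto simp: out_profile_def)
            \<comment> \<open>\<open>f\<close> is controlled only on the active domain. Context
              values at argument positions lie there because the atom holds, and so their images
              avoid \<open>ents s\<close>.\<close>
            have wD: "w x \<in> adom I" if "x < ?n" "x \<notin> V" for x
              using terms[OF w(2)] that by (force simp: override_on_def)
            have ov: "map f (map (override_on w c V) [0..<?n]) =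
                map (override_on (f \<circ> w) (f \<circ> c) V) [0..<?n]" for c
              by (auto simp: override_on_def)
            have "f \<circ> w \<in> out_profile {..<?n} ?\<rho>' V (ents s) (f \<circ> a)"
              using w(1) wD fwd[OF w(2)] unfolding ov by (auto simp: out_profile_def X)
            then have "Atom R (map f (map (override_on w a' V) [0..<?n])) \<in> ?rep"
              unfolding ov aa(2) by (simp add: out_profile_def)
            moreover have "set (map (override_on w a' V) [0..<?n]) \<subseteq> adom I"
              using wD aa by (auto simp: override_on_def X)
            ultimately have "?\<rho> (override_on w a' V)"
              by (rule bwd)
            with w(1) show "w \<in> out_profile {..<?n} ?\<rho> V X a'"
              by (simp add: out_profile_def)
          qed
          fix a a' assume "a \<in> ?A" "a' \<in> ?A" "out_profile {..<?n} ?\<rho>' V (ents s) (f \<circ> a)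
              = out_profile {..<?n} ?\<rho>' V (ents s) (f \<circ> a')"
          with sub[of a a'] sub[of a' a]
          show "out_profile {..<?n} ?\<rho> V X a = out_profile {..<?n} ?\<rho> V X a'"
            by (metis (no_types, lifting) subset_antisym)
        qed
      qed
    qed
  qed
qed

section \<open>From bounded index to colors\<close>

text \<open>To be instantiated with an extension as \<open>J\<close> and the addresses of the
  original instance; both have the same active domain.\<close>

locale addressed_instance =
  fixes S :: "('r, 'c) sig" and J :: "('r, ('c, 'n) trm) atom set" and adr :: "('c, 'n) trm \<Rightarrow> node"
  assumes sig: "signature S"
    and arity: "\<And>R ts. Atom R ts \<in> J \<Longrightarrow> R \<in> rels S \<and> length ts = ar S R"
    and cnst: "\<And>c. Cst c \<in> adom J \<Longrightarrow> c \<in> cnst S"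
    and antichain: "\<And>t u. t \<in> adom J \<Longrightarrow> u \<in> adom J \<Longrightarrow> prefix (adr t) (adr u) \<Longrightarrow> t = u"
    and top: "\<And>t. t \<in> adom J \<Longrightarrow> Atom (Top S) [t] \<in> J"
    and bounded: "bounded_instance S (range (below (adom J) adr)) J"
begin

abbreviation X :: "node \<Rightarrow> ('c, 'n) trm set" where
  "X \<equiv> below (adom J) adr"

abbreviation M :: nat where
  "M \<equiv> max_ar S"

lemma ar_le_M: "R \<in> rels S \<Longrightarrow> ar S R \<le> M"
  using sig by (simp add: signature_def max_ar_def)

lemma ar_pos: "R \<in> rels S \<Longrightarrow> 1 \<le> ar S R"
  using sig by (simp add: signature_def)

lemma X_mono: "X (s @ r) \<subseteq> X s"
  by (auto simp: below_def intro: append_prefixD)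

lemma X_disjoint: "X (s @ [False]) \<inter> X (s @ [True]) = {}"
  unfolding below_def by (auto simp: prefix_def)

lemma X_leaf: "t \<in> adom J \<Longrightarrow> X (adr t) = {t}"
  using antichain by (auto simp: below_def)

lemma X_below_leaf: "t \<in> adom J \<Longrightarrow> r \<noteq> [] \<Longrightarrow> X (adr t @ r) = {}"
  using X_leaf[of t] X_mono[of "adr t" r] by (auto simp: below_def)

lemma X_split:
  assumes "s \<notin> adr ` adom J"
  shows "X s = X (s @ [False]) \<union> X (s @ [True])"
proof
  show "X s \<subseteq> X (s @ [False]) \<union> X (s @ [True])"
  proof
    fix t assume t: "t \<in> X s"
    then obtain r where r: "adr t = s @ r" "t \<in> adom J"
      by (auto simp: below_def prefix_def)
    with assms obtain i r' where "r = i # r'"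
      by (cases r) auto
    with r show "t \<in> X (s @ [False]) \<union> X (s @ [True])"
      by (cases i) (auto simp: below_def)
  qed
  show "X (s @ [False]) \<union> X (s @ [True]) \<subseteq> X s"
    using X_mono by blast
qed

text \<open>
  A placement \<open>\<pi>\<close> may repeat and permute the entries of a tuple. Allowing this, instead of only
  increasing placements as in \<^const>\<open>weave\<close>, makes the classes a congruence for weaving without
  any computation with ranks of positions.
\<close>

definition fill :: "nat option list \<Rightarrow> ('c, 'n) trm list \<Rightarrow> (nat \<Rightarrow> ('c, 'n) trm) \<Rightarrow> ('c, 'n) trm list" where
  "fill \<pi> as b = map (\<lambda>i. case \<pi> ! i of None \<Rightarrow> b i | Some j \<Rightarrow> as ! j) [0..<length \<pi>]"

text \<open>All relations and placements are collected in one set, so a single class decides every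
  atom combining entries of the tuple with terms outside \<open>X s\<close>, including atoms without
  any context.\<close>

definition cls :: "node \<Rightarrow> ('c, 'n) trm list \<Rightarrow> ('r \<times> nat option list \<times> (nat \<Rightarrow> ('c, 'n) trm)) set" where
  "cls s as = {(R, \<pi>, b). R \<in> rels S \<and> length \<pi> = ar S R
     \<and> (\<forall>i<ar S R. case \<pi> ! i of None \<Rightarrow> b i \<notin> X s | Some j \<Rightarrow> j < length as)
     \<and> Atom R (fill \<pi> as b) \<in> J}"

definition tuples :: "node \<Rightarrow> nat \<Rightarrow> ('c, 'n) trm list set" where
  "tuples s k = {as. length as = k \<and> set as \<subseteq> X s}"

text \<open>A class amounts to a family of profiles of the placed tuple, indexed by relations and
  placements. The number of such families is bounded by a power whose base and exponent do not
  depend on the node.\<close>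

lemma few_cls: "\<exists>K. \<forall>s. \<forall>k\<le>M. few K (cls s) (tuples s k)"
proof -
  let ?\<rho> = "\<lambda>R v. Atom R (map v [0..<ar S R]) \<in> J"
  have "\<forall>R\<in>rels S. \<exists>N. \<forall>V. \<forall>Y\<in>range X. few N (out_profile {..<ar S R} (?\<rho> R) V Y) {v. \<forall>x\<in>V. v x \<in> Y}"
    using bounded by (simp add: bounded_instance_def bounded_index_def)
  then obtain N where N: "\<forall>R\<in>rels S. \<forall>V. \<forall>Y\<in>range X.
      few (N R) (out_profile {..<ar S R} (?\<rho> R) V Y) {v. \<forall>x\<in>V. v x \<in> Y}"
    by (rule bchoice[THEN exE])
  define n where "n = sum N (rels S)"
  have finr: "finite (rels S)"
    using sig by (simp add: signature_def)
  have n: "few n (out_profile {..<ar S R} (?\<rho> R) V (X s)) {v. \<forall>x\<in>V. v x \<in> X s}"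
    if "R \<in> rels S" for R V s
  proof (rule few_mono)
    show "few (N R) (out_profile {..<ar S R} (?\<rho> R) V (X s)) {v. \<forall>x\<in>V. v x \<in> X s}"
      using N that by blast
    show "N R \<le> n"
      unfolding n_def using that finr by (simp add: member_le_sum)
  qed
  define Idx where "Idx k = (SIGMA R:rels S. {\<pi>. set \<pi> \<subseteq> insert None (Some ` {..<k}) \<and> length \<pi> = ar S R})"
    for k :: nat
  have finI: "finite (Idx k)" for k
    unfolding Idx_def by (intro finite_SigmaI finr finite_lists_length_eq) auto
  have few: "few (n ^ card (Idx k)) (cls s) (tuples s k)" for s k
  proof -
    \<comment> \<open>Placing \<open>as\<close> by \<open>\<pi>\<close> gives a valuation whose
      inside variables are the positions marked \<open>Some\<close>. At a \<open>None\<close> its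
      value is unspecified, but there the context takes over.\<close>
    define f where "f = (\<lambda>(R, \<pi>) as. out_profile {..<ar S R} (?\<rho> R)
        {i. i < ar S R \<and> \<pi> ! i \<noteq> None} (X s) (\<lambda>i. as ! the (\<pi> ! i)))"
    have "few n (f p) (tuples s k)" if p: "p \<in> Idx k" for p
    proof -
      obtain R \<pi> where p': "p = (R, \<pi>)" by (cases p)
      with p have R: "R \<in> rels S" and \<pi>: "set \<pi> \<subseteq> insert None (Some ` {..<k})" "length \<pi> = ar S R"
        by (auto simp: Idx_def)
      show ?thesis
        unfolding f_def p' prod.case
      proof (rule few_reindex[OF n[OF R]], rule image_subsetI, rule CollectI, rule ballI)
        fix as i assume as: "as \<in> tuples s k" and i: "i \<in> {i. i < ar S R \<and> \<pi> ! i \<noteq> None}"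
        then have "\<pi> ! i \<in> set \<pi>" using \<pi> by auto
        with \<pi>(1) i have "the (\<pi> ! i) < k" by auto
        with as show "as ! the (\<pi> ! i) \<in> X s"
          using nth_mem by (auto simp: tuples_def)
      qed
    qed
    from few_restrict[OF finI this]
    show ?thesis
    proof (rule few_compose)
      fix as assume as: "as \<in> tuples s k"
      then have len: "length as = k" by (simp add: tuples_def)
      have *: "(R, \<pi>, b) \<in> cls s as \<longleftrightarrow> (R, \<pi>) \<in> Idx k \<and> b \<in> f (R, \<pi>) as" for R \<pi> b
      proof (cases "R \<in> rels S \<and> length \<pi> = ar S R")
        case True
        have "set \<pi> \<subseteq> insert None (Some ` {..<k}) \<longleftrightarrow>
            (\<forall>i<ar S R. case \<pi> ! i of None \<Rightarrow> True | Some j \<Rightarrow> j < k)"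
        proof -
          have "set \<pi> \<subseteq> insert None (Some ` {..<k}) \<longleftrightarrow>
              (\<forall>i<ar S R. \<pi> ! i \<in> insert None (Some ` {..<k}))"
            using True by (metis in_set_conv_nth subset_code(1))
          moreover have "p \<in> insert None (Some ` {..<k}) \<longleftrightarrow>
              (case p of None \<Rightarrow> True | Some j \<Rightarrow> j < k)" for p
            by (cases p) auto
          ultimately show ?thesis by simp
        qed
        then have I: "(R, \<pi>) \<in> Idx k \<longleftrightarrow> (\<forall>i<ar S R. case \<pi> ! i of None \<Rightarrow> True | Some j \<Rightarrow> j < k)"
          using True by (simp add: Idx_def)
        have fl: "map (override_on b (\<lambda>i. as ! the (\<pi> ! i)) {i. i < ar S R \<and> \<pi> ! i \<noteq> None}) [0..<ar S R]
            = fill \<pi> as b"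
          unfolding fill_def using True by (auto simp: override_on_def split: option.splits)
        have "b \<in> f (R, \<pi>) as \<longleftrightarrow> (\<forall>i<ar S R. \<pi> ! i = None \<longrightarrow> b i \<notin> X s) \<and> Atom R (fill \<pi> as b) \<in> J"
          unfolding f_def prod.case out_profile_def mem_Collect_eq fl by auto
        moreover have "(\<forall>i<ar S R. case \<pi> ! i of None \<Rightarrow> b i \<notin> X s | Some j \<Rightarrow> j < length as) \<longleftrightarrow>
            (\<forall>i<ar S R. case \<pi> ! i of None \<Rightarrow> True | Some j \<Rightarrow> j < k) \<and>
            (\<forall>i<ar S R. \<pi> ! i = None \<longrightarrow> b i \<notin> X s)"
          unfolding len by (auto split: option.splits)
        ultimately show ?thesis
          using True unfolding I by (auto simp: cls_def)
      qed (auto simp: cls_def Idx_def)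
      show "cls s as = (\<lambda>g. {(R, \<pi>, b). (R, \<pi>) \<in> Idx k \<and> b \<in> g (R, \<pi>)})
          (restrict (\<lambda>p. f p as) (Idx k))"
      proof (rule set_eqI)
        fix x :: "'r \<times> nat option list \<times> (nat \<Rightarrow> ('c, 'n) trm)"
        obtain R \<pi> b where x: "x = (R, \<pi>, b)" by (cases x)
        show "x \<in> cls s as \<longleftrightarrow> x \<in> (\<lambda>g. {(R, \<pi>, b). (R, \<pi>) \<in> Idx k \<and> b \<in> g (R, \<pi>)})
            (restrict (\<lambda>p. f p as) (Idx k))"
          unfolding x * by auto
      qed
    qed
  qed
  have "few (\<Sum>k\<le>M. n ^ card (Idx k)) (cls s) (tuples s k)" if "k \<le> M" for s k
  proof (rule few_mono[OF few])
    show "n ^ card (Idx k) \<le> (\<Sum>k\<le>M. n ^ card (Idx k))"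
      using that by (intro member_le_sum) auto
  qed
  then show ?thesis by blast
qed

section \<open>The classes are a congruence for recoloring and weaving\<close>

text \<open>A completion of \<open>es\<close> at \<open>s\<close> can be read as a completion of
  \<open>as\<close> at \<open>u\<close>: entries taken from \<open>as\<close> are placed, the others
  join the context. This is legal because those others avoid \<open>X u\<close> and the old context
  avoids the larger set \<open>X s\<close>.\<close>

lemma cls_subst:
  assumes eq: "cls u as = cls u as'" and len: "length es = length es'"
    and sub: "X u \<subseteq> X s"
    and es: "\<And>j. j < length es \<Longrightarrow> (\<exists>q<length as. es ! j = as ! q \<and> es' ! j = as' ! q)
      \<or> es ! j = es' ! j \<and> es ! j \<notin> X u"
  shows "cls s es \<subseteq> cls s es'"
proof
  fix x assume x: "x \<in> cls s es"
  obtain R \<pi> b where x': "x = (R, \<pi>, b)" by (cases x)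
  have R: "R \<in> rels S" and \<pi>: "length \<pi> = ar S R"
    and case_\<pi>: "\<And>i. i < ar S R \<Longrightarrow> case \<pi> ! i of None \<Rightarrow> b i \<notin> X s | Some j \<Rightarrow> j < length es"
    and atom: "Atom R (fill \<pi> es b) \<in> J"
    using x unfolding x' cls_def by auto
  have "\<forall>j. \<exists>p. j < length es \<longrightarrow> (case p of
      Some q \<Rightarrow> q < length as \<and> es ! j = as ! q \<and> es' ! j = as' ! q
    | None \<Rightarrow> es ! j = es' ! j \<and> es ! j \<notin> X u)"
  proof
    fix j
    show "\<exists>p. j < length es \<longrightarrow> (case p of
        Some q \<Rightarrow> q < length as \<and> es ! j = as ! q \<and> es' ! j = as' ! q
      | None \<Rightarrow> es ! j = es' ! j \<and> es ! j \<notin> X u)"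
    proof (cases "j < length es")
      case True
      from es[OF this] show ?thesis
      proof
        assume "\<exists>q<length as. es ! j = as ! q \<and> es' ! j = as' ! q"
        then obtain q where "q < length as" "es ! j = as ! q" "es' ! j = as' ! q" by blast
        then show ?thesis by (intro exI[of _ "Some q"]) simp
      next
        assume "es ! j = es' ! j \<and> es ! j \<notin> X u"
        then show ?thesis by (intro exI[of _ None]) auto
      qed
    qed simp
  qed
  then obtain r where r': "\<forall>j. j < length es \<longrightarrow> (case r j of
      Some q \<Rightarrow> q < length as \<and> es ! j = as ! q \<and> es' ! j = as' ! q
    | None \<Rightarrow> es ! j = es' ! j \<and> es ! j \<notin> X u)"
    by (rule choice[THEN exE])
  note r = r'[rule_format]
  \<comment> \<open>\<open>r j\<close> names the entry of \<open>as\<close> that supplies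
    \<open>es ! j\<close>, or is \<open>None\<close> when that entry is common to \<open>es\<close>
    and \<open>es'\<close>. The new placement composes \<open>\<pi>\<close> with this origin, and
    \<open>b'\<close> absorbs the common entries.\<close>
  define \<pi>' where "\<pi>' = map (\<lambda>p. Option.bind p r) \<pi>"
  define b' where "b' i = (case \<pi> ! i of None \<Rightarrow> b i | Some j \<Rightarrow> es ! j)" for i
  have \<pi>': "length \<pi>' = ar S R" "\<And>i. i < ar S R \<Longrightarrow> \<pi>' ! i = Option.bind (\<pi> ! i) r"
    using \<pi> by (auto simp: \<pi>'_def)
  have fill1: "fill \<pi>' as b' = fill \<pi> es b"
    unfolding fill_def \<pi> \<pi>'(1)
  proof (rule map_cong[OF refl])
    fix i assume "i \<in> set [0..<ar S R]"
    then have i: "i < ar S R" by simp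
    show "(case \<pi>' ! i of None \<Rightarrow> b' i | Some j \<Rightarrow> as ! j) = (case \<pi> ! i of None \<Rightarrow> b i | Some j \<Rightarrow> es ! j)"
    proof (cases "\<pi> ! i")
      case None
      with \<pi>'(2)[OF i] show ?thesis by (simp add: b'_def)
    next
      case (Some j)
      with case_\<pi>[OF i] have "j < length es" by simp
      with r[of j] \<pi>'(2)[OF i] Some show ?thesis by (cases "r j") (auto simp: b'_def)
    qed
  qed
  have fill2: "fill \<pi>' as' b' = fill \<pi> es' b"
    unfolding fill_def \<pi> \<pi>'(1)
  proof (rule map_cong[OF refl])
    fix i assume "i \<in> set [0..<ar S R]"
    then have i: "i < ar S R" by simp
    show "(case \<pi>' ! i of None \<Rightarrow> b' i | Some j \<Rightarrow> as' ! j) = (case \<pi> ! i of None \<Rightarrow> b i | Some j \<Rightarrow> es' ! j)"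
    proof (cases "\<pi> ! i")
      case None
      with \<pi>'(2)[OF i] show ?thesis by (simp add: b'_def)
    next
      case (Some j)
      with case_\<pi>[OF i] have "j < length es" by simp
      with r[of j] \<pi>'(2)[OF i] Some show ?thesis by (cases "r j") (auto simp: b'_def)
    qed
  qed
  have "case \<pi>' ! i of None \<Rightarrow> b' i \<notin> X u | Some j \<Rightarrow> j < length as" if i: "i < ar S R" for i
  proof (cases "\<pi> ! i")
    case None
    with case_\<pi>[OF i] \<pi>'(2)[OF i] sub show ?thesis by (auto simp: b'_def)
  next
    case (Some j)
    with case_\<pi>[OF i] have "j < length es" by simp
    with r[of j] \<pi>'(2)[OF i] Some show ?thesis by (cases "r j") (auto simp: b'_def)
  qed
  with R \<pi>'(1) atom have "(R, \<pi>', b') \<in> cls u as"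
    unfolding cls_def fill1[symmetric] by auto
  then have "Atom R (fill \<pi> es' b) \<in> J"
    unfolding eq unfolding cls_def fill2[symmetric] by auto
  with R \<pi> case_\<pi>[unfolded len] show "x \<in> cls s es'"
    unfolding x' cls_def by blast
qed

lemma cls_recol:
  assumes "cls (s @ [i]) as = cls (s @ [i]) as'" and "length as = length as'"
  shows "cls s as = cls s as'"
  using cls_subst[OF assms X_mono[of s "[i]"]] cls_subst[OF assms[symmetric] X_mono[of s "[i]"]] assms(2)
  by (metis subset_antisym)

text \<open>The two parts are exchanged one after the other. During each exchange the other part
  acts as context, since the subtrees of the two children share no term.\<close>

lemma cls_weave_subset:
  assumes a: "cls (s @ [False]) as = cls (s @ [False]) as'" "length as = length as'"
      "set as' \<subseteq> X (s @ [False])"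
    and b: "cls (s @ [True]) bs = cls (s @ [True]) bs'" "length bs = length bs'"
      "set bs \<subseteq> X (s @ [True])"
    and I: "I \<subseteq> {1..length as + length bs}" "card I = length as"
  shows "cls s (weave I as bs) \<subseteq> cls s (weave I as' bs')"
proof -
  have "cls s (weave I as bs) \<subseteq> cls s (weave I as' bs)"
  proof (rule cls_subst[OF a(1)])
    fix j assume "j < length (weave I as bs)"
    then have j: "j < length as + length bs" by simp
    have w': "weave I as' bs ! j = (if Suc j \<in> I then as' ! card {i\<in>{1..<Suc j}. i \<in> I}
        else bs ! card {i\<in>{1..<Suc j}. i \<notin> I})"
      using j a(2) by (intro weave_nth) simp
    show "(\<exists>q<length as. weave I as bs ! j = as ! q \<and> weave I as' bs ! j = as' ! q)
        \<or> weave I as bs ! j = weave I as' bs ! j \<and> weave I as bs ! j \<notin> X (s @ [False])"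
    proof (rule weave_nth_cases[OF I j])
      assume *: "Suc j \<notin> I" "card {i\<in>{1..<Suc j}. i \<notin> I} < length bs"
        "weave I as bs ! j = bs ! card {i\<in>{1..<Suc j}. i \<notin> I}"
      then have "weave I as bs ! j \<in> X (s @ [True])"
        using b(3) nth_mem by (metis subsetD)
      with * w' X_disjoint show ?thesis by auto
    qed (use w' in auto)
  qed (use a X_mono in auto)
  also have "\<dots> \<subseteq> cls s (weave I as' bs')"
  proof (rule cls_subst[OF b(1)])
    fix j assume "j < length (weave I as' bs)"
    then have j: "j < length as' + length bs" by simp
    have I': "I \<subseteq> {1..length as' + length bs}" "card I = length as'"
      using I a(2) by auto
    have w': "weave I as' bs' ! j = (if Suc j \<in> I then as' ! card {i\<in>{1..<Suc j}. i \<in> I}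
        else bs' ! card {i\<in>{1..<Suc j}. i \<notin> I})"
      using j b(2) by (intro weave_nth) simp
    show "(\<exists>q<length bs. weave I as' bs ! j = bs ! q \<and> weave I as' bs' ! j = bs' ! q)
        \<or> weave I as' bs ! j = weave I as' bs' ! j \<and> weave I as' bs ! j \<notin> X (s @ [True])"
    proof (rule weave_nth_cases[OF I' j])
      assume *: "Suc j \<in> I" "card {i\<in>{1..<Suc j}. i \<in> I} < length as'"
        "weave I as' bs ! j = as' ! card {i\<in>{1..<Suc j}. i \<in> I}"
      then have "weave I as' bs ! j \<in> X (s @ [False])"
        using a(3) nth_mem by (metis subsetD)
      with * w' X_disjoint show ?thesis by auto
    qed (use w' in auto)
  qed (use b X_mono in auto)
  finally show ?thesis .
qed

lemma cls_weave:
  assumes a: "cls (s @ [False]) as = cls (s @ [False]) as'" "length as = length as'"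
      "set as \<subseteq> X (s @ [False])" "set as' \<subseteq> X (s @ [False])"
    and b: "cls (s @ [True]) bs = cls (s @ [True]) bs'" "length bs = length bs'"
      "set bs \<subseteq> X (s @ [True])" "set bs' \<subseteq> X (s @ [True])"
    and I: "I \<subseteq> {1..length as + length bs}" "card I = length as"
  shows "cls s (weave I as bs) = cls s (weave I as' bs')"
proof
  show "cls s (weave I as bs) \<subseteq> cls s (weave I as' bs')"
    by (rule cls_weave_subset[OF a(1,2,4) b(1-3) I])
  show "cls s (weave I as' bs') \<subseteq> cls s (weave I as bs)"
    by (rule cls_weave_subset[OF a(1)[symmetric] a(2)[symmetric] a(3) b(1)[symmetric]
          b(2)[symmetric] b(4)]) (use I a(2) b(2) in auto)
qed

section \<open>Class numbers as colors\<close>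

text \<open>Number 0 is imposed at addresses because the semantics fixes the colors of a pseudoleaf
  to the distinguished ones, encoded below as \<open>(i, 0)\<close>. Each length is numbered
  separately, since the color also stores the length.\<close>

definition numbering :: "nat \<Rightarrow> (node \<Rightarrow> nat \<Rightarrow> ('r \<times> nat option list \<times> (nat \<Rightarrow> ('c, 'n) trm)) set \<Rightarrow> nat) \<Rightarrow> bool"
  where "numbering K e \<longleftrightarrow> (\<forall>s. \<forall>k\<le>M. inj_on (e s k) (cls s ` tuples s k)
    \<and> (\<forall>as\<in>tuples s k. e s k (cls s as) \<le> K)
    \<and> (s \<in> adr ` adom J \<longrightarrow> (\<forall>as\<in>tuples s k. e s k (cls s as) = 0)))"

lemma ex_numbering: "\<exists>K e. numbering K e"
proof -
  obtain K where K: "\<And>s k. k \<le> M \<Longrightarrow> few K (cls s) (tuples s k)"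
    using few_cls by blast
  have "\<exists>e. k \<le> M \<longrightarrow> inj_on e (cls s ` tuples s k) \<and> (\<forall>as\<in>tuples s k. e (cls s as) \<le> K)
      \<and> (s \<in> adr ` adom J \<longrightarrow> (\<forall>as\<in>tuples s k. e (cls s as) = (0::nat)))" for s k
  proof (cases "s \<in> adr ` adom J")
    case True
    then obtain t where t: "t \<in> adom J" "s = adr t" by blast
    \<comment> \<open>Only \<open>t\<close> lies below its own address, so there is at most one
      tuple of each length and the constant numbering 0 is injective.\<close>
    have "as = replicate k t" if "as \<in> tuples s k" for as
      by (rule replicate_eqI) (use that X_leaf[OF t(1)] t(2) in \<open>auto simp: tuples_def\<close>)
    then have "tuples s k \<subseteq> {replicate k t}" by blast
    then have "cls s ` tuples s k \<subseteq> {cls s (replicate k t)}" by blast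
    then have "inj_on (\<lambda>_. 0::nat) (cls s ` tuples s k)"
      by (rule inj_on_subset[rotated]) simp
    then show ?thesis by (intro exI[of _ "\<lambda>_. 0"]) simp
  next
    case False
    show ?thesis
    proof (cases "k \<le> M")
      case True
      let ?C = "cls s ` tuples s k"
      have C: "finite ?C" "card ?C \<le> K"
        using K[OF True, of s] by (auto simp: few_def)
      from ex_bij_betw_finite_nat[OF C(1)] obtain e where e: "bij_betw e ?C {0..<card ?C}" by blast
      have "e (cls s as) \<le> K" if "as \<in> tuples s k" for as
      proof -
        have "e (cls s as) \<in> {0..<card ?C}"
          using e that by (auto simp: bij_betw_def)
        with C(2) show ?thesis by simp
      qed
      with e False show ?thesis by (auto simp: bij_betw_def)
    qed simp
  qed
  then have "\<forall>s k. \<exists>e. k \<le> M \<longrightarrow> inj_on e (cls s ` tuples s k) \<and> (\<forall>as\<in>tuples s k. e (cls s as) \<le> K)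
      \<and> (s \<in> adr ` adom J \<longrightarrow> (\<forall>as\<in>tuples s k. e (cls s as) = (0::nat)))" by blast
  then obtain e where "\<forall>s k. k \<le> M \<longrightarrow> inj_on (e s k) (cls s ` tuples s k)
      \<and> (\<forall>as\<in>tuples s k. e s k (cls s as) \<le> K)
      \<and> (s \<in> adr ` adom J \<longrightarrow> (\<forall>as\<in>tuples s k. e s k (cls s as) = (0::nat)))"
    unfolding choice_iff by (elim exE)
  then show ?thesis
    unfolding numbering_def by blast
qed

end

locale numbered_instance = addressed_instance S J adr
  for S :: "('r, 'c) sig" and J :: "('r, ('c, 'n) trm) atom set" and adr +
  fixes K :: nat and e :: "node \<Rightarrow> nat \<Rightarrow> ('r \<times> nat option list \<times> (nat \<Rightarrow> ('c, 'n) trm)) set \<Rightarrow> nat"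
  assumes numbering: "numbering K e"
begin

definition tuple :: "node \<Rightarrow> ('c, 'n) trm list \<Rightarrow> bool" where
  "tuple s as \<longleftrightarrow> as \<noteq> [] \<and> length as \<le> M \<and> set as \<subseteq> X s"

definition col :: "node \<Rightarrow> ('c, 'n) trm list \<Rightarrow> nat" where
  "col s as = prod_encode (length as, e s (length as) (cls s as))"

definition pal :: palette where
  "pal = \<lparr>colors = prod_encode ` ({1..M} \<times> {..K}), car = (\<lambda>\<kappa>. fst (prod_decode \<kappa>)),
     orig = (\<lambda>i. prod_encode (i, 0))\<rparr>"

lemma palette_for_pal: "palette_for S pal"
  by (auto simp: palette_for_def pal_def)

lemma car_col: "car pal (col s as) = length as"
  by (simp add: pal_def col_def)

lemma col_colors:
  assumes "tuple s as"
  shows "col s as \<in> colors pal"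
proof -
  have "as \<in> tuples s (length as)" "length as \<le> M" "1 \<le> length as"
    using assms by (auto simp: tuple_def tuples_def Suc_le_eq)
  then show ?thesis
    using numbering by (auto simp: numbering_def pal_def col_def)
qed

lemma col_eqD:
  assumes "tuple s as" and "tuple s as'" and "col s as = col s as'"
  shows "length as = length as'" and "cls s as = cls s as'"
proof -
  from assms(3) show len: "length as = length as'"
    by (simp add: col_def)
  have "as \<in> tuples s (length as)" "as' \<in> tuples s (length as)" "length as \<le> M"
    using assms(1,2) len by (auto simp: tuple_def tuples_def)
  moreover have "e s (length as) (cls s as) = e s (length as) (cls s as')"
    using assms(3) len by (simp add: col_def)
  moreover have "inj_on (e s (length as)) (cls s ` tuples s (length as))"
    using numbering \<open>length as \<le> M\<close> by (simp add: numbering_def)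
  ultimately show "cls s as = cls s as'"
    by (auto dest: inj_onD)
qed

lemma col_leaf:
  assumes "t \<in> adom J" and "1 \<le> i" and "i \<le> M"
  shows "col (adr t) (replicate i t) = orig pal i"
proof -
  have "replicate i t \<in> tuples (adr t) i"
    unfolding tuples_def X_leaf[OF assms(1)] by (simp add: set_replicate_conv_if)
  then have "e (adr t) i (cls (adr t) (replicate i t)) = 0"
    using numbering assms unfolding numbering_def by blast
  then show ?thesis
    by (simp add: col_def pal_def)
qed

lemma tuple_child: "tuple (s @ [i]) as \<Longrightarrow> tuple s as"
  using X_mono by (auto simp: tuple_def)

lemma col_recol:
  assumes "tuple (s @ [i]) as" and "tuple (s @ [i]) as'" and "col (s @ [i]) as = col (s @ [i]) as'"
  shows "col s as = col s as'"
  using cls_recol[of s i as as'] col_eqD[OF assms] by (simp add: col_def)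

definition splitting :: "nat set \<Rightarrow> 'a list \<Rightarrow> 'b list \<Rightarrow> bool" where
  "splitting I as bs \<longleftrightarrow> I \<subseteq> {1..length as + length bs} \<and> card I = length as \<and> length as + length bs \<le> M"

lemma tuple_weave:
  assumes "tuple (s @ [False]) as" and "tuple (s @ [True]) bs" and "splitting I as bs"
  shows "tuple s (weave I as bs)"
proof -
  have "set (weave I as bs) \<subseteq> set as \<union> set bs"
    using assms(3) by (intro set_weave) (auto simp: splitting_def)
  moreover have "set as \<subseteq> X s" "set bs \<subseteq> X s"
    using assms tuple_child by (auto simp: tuple_def)
  moreover have "weave I as bs \<noteq> []"
    using assms(1) length_weave[of I as bs] by (auto simp: tuple_def simp del: length_weave)
  ultimately show ?thesis
    using assms(3) by (auto simp: tuple_def splitting_def)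
qed

text \<open>For fixed \<open>I\<close> the target color depends on the source colors alone; this is
  what keeps the \<open>Add\<close> instructions compatible.\<close>

lemma col_weave:
  assumes "tuple (s @ [False]) as" "tuple (s @ [False]) as'" "col (s @ [False]) as = col (s @ [False]) as'"
    and "tuple (s @ [True]) bs" "tuple (s @ [True]) bs'" "col (s @ [True]) bs = col (s @ [True]) bs'"
    and "splitting I as bs"
  shows "col s (weave I as bs) = col s (weave I as' bs')"
proof -
  note a = col_eqD[OF assms(1-3)] and b = col_eqD[OF assms(4-6)]
  have "cls s (weave I as bs) = cls s (weave I as' bs')"
    by (rule cls_weave[OF a(2) a(1) _ _ b(2) b(1)]) (use assms in \<open>auto simp: tuple_def splitting_def\<close>)
  then show ?thesis
    using a(1) b(1) by (simp add: col_def)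
qed

section \<open>The tree of classes\<close>

primrec leaf_dec :: "('c, 'n) trm \<Rightarrow> ('r, 'c) decorator" where
  "leaf_dec (Cst c) = DCst c"
| "leaf_dec (Null n) = DStar"

definition adds :: "node \<Rightarrow> ('r, 'c) decorator set" where
  "adds s = {Add (col (s @ [False]) as) (col (s @ [True]) bs) I (col s (weave I as bs)) | as bs I.
     tuple (s @ [False]) as \<and> tuple (s @ [True]) bs \<and> splitting I as bs}"

text \<open>Every color present below a child is recolored, possibly to itself: class numbers at
  different nodes are unrelated, so an inherited color could be wrong.\<close>

definition recols :: "node \<Rightarrow> ('r, 'c) decorator set" where
  "recols s = {Recol i (col (s @ [i]) as) (col s as) | i as. tuple (s @ [i]) as}"

text \<open>At the empty address no term of the instance is outside, and the class of a tuple
  decides which relations hold of it. Atoms can therefore all be created in one place.\<close>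

definition mats :: "('r, 'c) decorator set" where
  "mats = {Mat False (col [] as) R | R as. Atom R as \<in> J}"

definition inner :: "node \<Rightarrow> ('r, 'c) decorator set" where
  "inner s = (if s \<in> adr ` adom J then leaf_dec ` {t\<in>adom J. adr t = s} else adds s \<union> recols s)"

text \<open>
  The whole construction sits below the left child of the root, so that the root can materialise
  all atoms, including those over a single term addressed by the empty word.
\<close>

definition tree :: "node \<Rightarrow> ('r, 'c) decorator set" where
  "tree u = (case u of [] \<Rightarrow> mats | b # s \<Rightarrow> if b then {} else inner s)"

lemma tree_simps [simp]:
  "tree [] = mats" "tree (True # s) = {}" "tree (False # s) = inner s"
  by (simp_all add: tree_def)

lemma inner_leaf: "t \<in> adom J \<Longrightarrow> inner (adr t) = {leaf_dec t}"
  using antichain by (fastforce simp: inner_def)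

lemma inner_node: "s \<notin> adr ` adom J \<Longrightarrow> inner s = adds s \<union> recols s"
  by (simp add: inner_def)

lemma adr_inj: "t \<in> adom J \<Longrightarrow> u \<in> adom J \<Longrightarrow> adr t = adr u \<Longrightarrow> t = u"
  by (rule antichain) simp_all

lemma leaf_dec_iff: "DCst c = leaf_dec t \<longleftrightarrow> t = Cst c" "DStar = leaf_dec t \<longleftrightarrow> (\<exists>n. t = Null n)"
  by (cases t; auto)+

lemma DCst_inner: "DCst c \<in> inner s \<longleftrightarrow> Cst c \<in> adom J \<and> adr (Cst c) = s"
proof (cases "s \<in> adr ` adom J")
  case True
  then obtain t where t: "t \<in> adom J" "s = adr t" by blast
  have "DCst c \<in> inner s \<longleftrightarrow> t = Cst c"
    unfolding t(2) inner_leaf[OF t(1)] by (simp add: leaf_dec_iff)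
  also have "\<dots> \<longleftrightarrow> Cst c \<in> adom J \<and> adr (Cst c) = s"
    using t adr_inj by metis
  finally show ?thesis .
next
  case False
  then show ?thesis
    by (auto simp: inner_node adds_def recols_def)
qed

lemma DStar_inner: "DStar \<in> inner s \<longleftrightarrow> (\<exists>n. Null n \<in> adom J \<and> adr (Null n) = s)"
proof (cases "s \<in> adr ` adom J")
  case True
  then obtain t where t: "t \<in> adom J" "s = adr t" by blast
  have "DStar \<in> inner s \<longleftrightarrow> (\<exists>n. t = Null n)"
    unfolding t(2) inner_leaf[OF t(1)] by (simp add: leaf_dec_iff)
  also have "\<dots> \<longleftrightarrow> (\<exists>n. Null n \<in> adom J \<and> adr (Null n) = s)"
    using t adr_inj by metis
  finally show ?thesis .
next
  case False
  then show ?thesis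
    by (auto simp: inner_node adds_def recols_def)
qed

lemma pseudoleaf_tree: "pseudoleaf tree u \<longleftrightarrow> (\<exists>t\<in>adom J. u = False # adr t)"
proof (cases u)
  case Nil
  then show ?thesis by (auto simp: pseudoleaf_def mats_def)
next
  case (Cons b s)
  show ?thesis
  proof (cases b)
    case True
    with Cons show ?thesis by (auto simp: pseudoleaf_def)
  next
    case False
    have "(\<exists>t\<in>adom J. s = adr t) \<longleftrightarrow> (\<exists>c. Cst c \<in> adom J \<and> adr (Cst c) = s) \<or>
        (\<exists>n. Null n \<in> adom J \<and> adr (Null n) = s)"
      by (metis trm.exhaust)
    with False Cons show ?thesis
      by (auto simp: pseudoleaf_def DCst_inner DStar_inner)
  qed
qed

lemma inner_below_leaf:
  assumes "t \<in> adom J" and "r \<noteq> []"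
  shows "inner (adr t @ r) = {}"
proof -
  have "adr t @ r \<notin> adr ` adom J"
  proof
    assume "adr t @ r \<in> adr ` adom J"
    then obtain u where u: "u \<in> adom J" "adr u = adr t @ r" by auto
    with antichain[OF assms(1) u(1)] have "t = u" by simp
    with u assms(2) show False by simp
  qed
  moreover have "X (adr t @ r @ [i]) = {}" for i
    by (rule X_below_leaf[OF assms(1)]) simp
  ultimately show ?thesis
    by (auto simp: inner_node adds_def recols_def tuple_def)
qed

lemma tuple_atom: "Atom R as \<in> J \<Longrightarrow> tuple [] as"
proof -
  assume a: "Atom R as \<in> J"
  then have "set as \<subseteq> adom J"
    by (force simp: adom_def)
  then show ?thesis
    using arity[OF a] ar_pos[of R] ar_le_M[of R] by (auto simp: tuple_def below_def)
qed

lemma decorator_over_tree: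
  assumes "d \<in> tree u"
  shows "decorator_over S pal d"
proof -
  have add: "decorator_over S pal d" if "d \<in> adds s" for s
  proof -
    from that obtain as bs I where d: "d = Add (col (s @ [False]) as) (col (s @ [True]) bs) I (col s (weave I as bs))"
        "tuple (s @ [False]) as" "tuple (s @ [True]) bs" "splitting I as bs"
      by (auto simp: adds_def)
    \<comment> \<open>The second part is non-empty, so \<open>I\<close> is a proper subset, as
      \<open>Add\<close> demands.\<close>
    have "I \<noteq> {1..length as + length bs}"
      using d by (auto simp: splitting_def tuple_def)
    then show ?thesis
      using d col_colors tuple_weave[OF d(2-4)] by (auto simp: car_col splitting_def)
  qed
  have rec: "decorator_over S pal d" if "d \<in> recols s" for s
    using that col_colors tuple_child by (auto simp: recols_def car_col)
  have mat: "decorator_over S pal d" if "d \<in> mats"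
    using that col_colors tuple_atom arity by (auto simp: mats_def car_col)
  have leaf: "decorator_over S pal (leaf_dec t)" if "t \<in> adom J" for t
    using that cnst by (cases t) auto
  show ?thesis
  proof (cases u)
    case Nil
    with assms mat show ?thesis by simp
  next
    case (Cons b s)
    with assms have "\<not> b" "d \<in> inner s"
      by (auto simp: tree_def split: if_splits)
    with add rec leaf show ?thesis
      by (auto simp: inner_def split: if_splits)
  qed
qed

lemma well_decorated_tree: "well_decorated S pal tree"
  unfolding well_decorated_def
proof (intro conjI allI impI ballI)
  fix s d assume "d \<in> tree s"
  then show "decorator_over S pal d" by (rule decorator_over_tree)
next
  fix s assume d: "DStar \<in> tree s"
  then have "pseudoleaf tree s" by (auto simp: pseudoleaf_def)
  with d show "tree s = {DStar}"
    using inner_leaf by (auto simp: pseudoleaf_tree)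
next
  fix s c assume d: "DCst c \<in> tree s"
  then have "pseudoleaf tree s" by (auto simp: pseudoleaf_def)
  with d show "tree s = {DCst c}"
    using inner_leaf by (auto simp: pseudoleaf_tree)
next
  fix s s' :: node assume "pseudoleaf tree s \<and> s' \<noteq> []"
  then show "tree (s @ s') = {}"
    using inner_below_leaf by (auto simp: pseudoleaf_tree)
next
  fix c s s' assume d: "DCst c \<in> tree s \<and> DCst c \<in> tree s'"
  then have "pseudoleaf tree s" "pseudoleaf tree s'" by (auto simp: pseudoleaf_def)
  with d show "s = s'"
    by (auto simp: pseudoleaf_tree DCst_inner)
next
  fix s \<kappa> \<mu> I \<nu> \<nu>' assume d: "Add \<kappa> \<mu> I \<nu> \<in> tree s \<and> Add \<kappa> \<mu> I \<nu>' \<in> tree s"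
  have "False # r = s \<and> Add \<kappa> \<mu> I \<nu> \<in> adds r" if "Add \<kappa> \<mu> I \<nu> \<in> tree s" "r = tl s" for r \<nu>
  proof (cases s)
    case (Cons b q)
    have "Add \<kappa> \<mu> I \<nu> \<noteq> leaf_dec t" for t by (cases t) auto
    with that Cons show ?thesis
      by (cases b) (auto simp: inner_def recols_def split: if_splits)
  qed (use that in \<open>auto simp: mats_def\<close>)
  with d obtain r where "Add \<kappa> \<mu> I \<nu> \<in> adds r" "Add \<kappa> \<mu> I \<nu>' \<in> adds r" by blast
  then show "\<nu> = \<nu>'"
  proof -
    assume "Add \<kappa> \<mu> I \<nu> \<in> adds r" "Add \<kappa> \<mu> I \<nu>' \<in> adds r"
    from this(1) obtain as bs where 1:
        "\<kappa> = col (r @ [False]) as" "\<mu> = col (r @ [True]) bs" "\<nu> = col r (weave I as bs)"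
        "tuple (r @ [False]) as" "tuple (r @ [True]) bs" "splitting I as bs"
      by (auto simp: adds_def)
    from \<open>Add \<kappa> \<mu> I \<nu>' \<in> adds r\<close> obtain as' bs' where
        "\<kappa> = col (r @ [False]) as'" "\<mu> = col (r @ [True]) bs'" "\<nu>' = col r (weave I as' bs')"
        "tuple (r @ [False]) as'" "tuple (r @ [True]) bs'"
      by (auto simp: adds_def)
    with 1 show ?thesis
      using col_weave[of r as as' bs bs' I] by simp
  qed
next
  fix s i \<kappa> \<nu> \<nu>' assume d: "Recol i \<kappa> \<nu> \<in> tree s \<and> Recol i \<kappa> \<nu>' \<in> tree s"
  have "False # r = s \<and> Recol i \<kappa> \<nu> \<in> recols r" if "Recol i \<kappa> \<nu> \<in> tree s" "r = tl s" for r \<nu>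
  proof (cases s)
    case (Cons b q)
    have "Recol i \<kappa> \<nu> \<noteq> leaf_dec t" for t by (cases t) auto
    with that Cons show ?thesis
      by (cases b) (auto simp: inner_def adds_def split: if_splits)
  qed (use that in \<open>auto simp: mats_def\<close>)
  with d obtain r where "Recol i \<kappa> \<nu> \<in> recols r" "Recol i \<kappa> \<nu>' \<in> recols r" by blast
  then show "\<nu> = \<nu>'"
  proof -
    assume "Recol i \<kappa> \<nu> \<in> recols r" "Recol i \<kappa> \<nu>' \<in> recols r"
    from this(1) obtain as where 1: "\<kappa> = col (r @ [i]) as" "\<nu> = col r as" "tuple (r @ [i]) as"
      by (auto simp: recols_def)
    from \<open>Recol i \<kappa> \<nu>' \<in> recols r\<close> obtain as' where
        "\<kappa> = col (r @ [i]) as'" "\<nu>' = col r as'" "tuple (r @ [i]) as'"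
      by (auto simp: recols_def)
    with 1 show ?thesis
      using col_recol[of r i as as'] by simp
  qed
qed

section \<open>The tree represents the instance up to renaming of nulls\<close>

definition ren :: "('c, 'n) trm \<Rightarrow> ('c, node) trm" where
  "ren t = (case t of Cst c \<Rightarrow> Cst c | Null n \<Rightarrow> Null (False # adr t))"

lemma ren_inj: "inj_on ren (adom J)"
proof (rule inj_onI)
  fix t u assume "t \<in> adom J" "u \<in> adom J" "ren t = ren u"
  then show "t = u"
    using antichain[of t u] by (cases t; cases u) (auto simp: ren_def)
qed

text \<open>An instruction was put into the tree for some representatives of its source classes; the
  congruence lemmas give the same target color for the tuples actually at hand.\<close>

lemma in_col_tree_sound:
  assumes "in_col S pal tree u \<nu> es"
  shows "u = False # s \<Longrightarrow> \<exists>as. tuple s as \<and> es = map ren as \<and> \<nu> = col s as"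
  using assms
proof (induction arbitrary: s)
  case (leaf_cst c u i)
  then have t: "Cst c \<in> adom J" "adr (Cst c) = s"
    by (auto simp: DCst_inner)
  have "tuple s (replicate i (Cst c))"
    using leaf_cst(2) X_leaf[OF t(1)] t(2) by (auto simp: tuple_def)
  moreover have "map ren (replicate i (Cst c)) = replicate i (Cst c)"
    by (simp add: ren_def)
  moreover have "col s (replicate i (Cst c)) = orig pal i"
    using col_leaf[OF t(1), of i] t(2) leaf_cst(2) by simp
  ultimately show ?case by metis
next
  case (leaf_star u i)
  then obtain n where t: "Null n \<in> adom J" "adr (Null n) = s"
    by (auto simp: DStar_inner)
  have "tuple s (replicate i (Null n))"
    using leaf_star(2) X_leaf[OF t(1)] t(2) by (auto simp: tuple_def)
  moreover have "map ren (replicate i (Null n)) = replicate i (Null u)"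
    using t leaf_star by (simp add: ren_def)
  moreover have "col s (replicate i (Null n)) = orig pal i"
    using col_leaf[OF t(1), of i] t(2) leaf_star(2) by simp
  ultimately show ?case by metis
next
  case (add u \<kappa> \<mu> I \<nu> as bs)
  obtain as' where as': "tuple (s @ [False]) as'" "as = map ren as'" "\<kappa> = col (s @ [False]) as'"
    using add.IH(1)[of "s @ [False]"] add.prems by auto
  obtain bs' where bs': "tuple (s @ [True]) bs'" "bs = map ren bs'" "\<mu> = col (s @ [True]) bs'"
    using add.IH(2)[of "s @ [True]"] add.prems by auto
  have "s \<notin> adr ` adom J"
    using add.hyps(1) add.prems by (auto simp: pseudoleaf_tree)
  then have "Add \<kappa> \<mu> I \<nu> \<in> adds s"
    using add.hyps(2) add.prems by (auto simp: inner_node recols_def)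
  then obtain as1 bs1 where 1: "\<kappa> = col (s @ [False]) as1" "\<mu> = col (s @ [True]) bs1"
      "\<nu> = col s (weave I as1 bs1)" "tuple (s @ [False]) as1" "tuple (s @ [True]) bs1" "splitting I as1 bs1"
    by (auto simp: adds_def)
  have eq: "length as1 = length as'" "length bs1 = length bs'"
    using col_eqD(1)[OF 1(4) as'(1)] col_eqD(1)[OF 1(5) bs'(1)] 1(1,2) as'(3) bs'(3) by auto
  then have sp: "splitting I as' bs'"
    using 1(6) by (simp add: splitting_def)
  have "\<nu> = col s (weave I as' bs')"
    unfolding 1(3) by (rule col_weave) (use 1 as' bs' in auto)
  moreover have "weave I as bs = map ren (weave I as' bs')"
    unfolding as'(2) bs'(2) using sp by (intro map_weave[symmetric]) (auto simp: splitting_def)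
  ultimately show ?case
    using tuple_weave[OF as'(1) bs'(1) sp] by blast
next
  case (recol u i \<kappa> \<nu> as)
  obtain as' where as': "tuple (s @ [i]) as'" "as = map ren as'" "\<kappa> = col (s @ [i]) as'"
    using recol.IH[of "s @ [i]"] recol.prems by auto
  have "s \<notin> adr ` adom J"
    using recol.hyps(1) recol.prems by (auto simp: pseudoleaf_tree)
  then have "Recol i \<kappa> \<nu> \<in> recols s"
    using recol.hyps(2) recol.prems by (auto simp: inner_node adds_def)
  then obtain as1 where 1: "\<kappa> = col (s @ [i]) as1" "\<nu> = col s as1" "tuple (s @ [i]) as1"
    by (auto simp: recols_def)
  have "\<nu> = col s as'"
    unfolding 1(2) by (rule col_recol[OF 1(3) as'(1)]) (use 1 as' in simp)
  with as' tuple_child show ?case by blast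
next
  case (keep u i \<nu> as)
  obtain as' where as': "tuple (s @ [i]) as'" "as = map ren as'" "\<nu> = col (s @ [i]) as'"
    using keep.IH[of "s @ [i]"] keep.prems by auto
  have "s \<notin> adr ` adom J"
    using keep.hyps(1) keep.prems by (auto simp: pseudoleaf_tree)
  \<comment> \<open>The color is recolored at this node, so the \<open>keep\<close> rule cannot have
    fired.\<close>
  then have "Recol i \<nu> (col s as') \<in> tree u"
    using keep.prems as' by (auto simp: inner_node recols_def)
  with keep.hyps(2) show ?case by blast
qed

lemma in_col_tree_leaf:
  assumes t: "t \<in> adom J" and as: "tuple (adr t) as"
  shows "in_col S pal tree (False # adr t) (col (adr t) as) (map ren as)"
proof -
  let ?i = "length as"
  have as': "as = replicate ?i t"
    by (rule replicate_eqI) (use as X_leaf[OF t] in \<open>auto simp: tuple_def\<close>)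
  have i: "1 \<le> ?i" "?i \<le> M"
    using as by (auto simp: tuple_def Suc_le_eq)
  have "in_col S pal tree (False # adr t) (orig pal ?i) (replicate ?i (ren t))"
  proof (cases t)
    case (Cst c)
    then have "DCst c \<in> tree (False # adr t)" using t by (simp add: DCst_inner)
    from in_col.leaf_cst[where i = ?i and T = tree and s = "False # adr t" and S = S and L = pal, OF this] i Cst show ?thesis by (simp add: ren_def)
  next
    case (Null n)
    then have "DStar \<in> tree (False # adr t)" using t by (auto simp: DStar_inner)
    from in_col.leaf_star[where i = ?i and T = tree and s = "False # adr t" and S = S and L = pal, OF this] i Null show ?thesis by (simp add: ren_def)
  qed
  moreover have "col (adr t) as = orig pal ?i"
    using col_leaf[OF t i] as' by simp
  moreover have "map ren as = replicate ?i (ren t)"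
    using as' by (metis map_replicate)
  ultimately show ?thesis by simp
qed

text \<open>Induction on how far the addresses of the entries reach below \<open>s\<close>: the tree
  may be infinite, but a tuple has finitely many entries, each at finite depth.\<close>

lemma in_col_tree_complete:
  assumes "tuple s as"
  shows "in_col S pal tree (False # s) (col s as) (map ren as)"
proof -
  define n where "n = Max ((\<lambda>t. length (adr t)) ` set as)"
  have "\<forall>t\<in>set as. length (adr t) \<le> length s + n"
    by (auto simp: n_def intro!: trans_le_add2)
  with assms show ?thesis
  proof (induction n arbitrary: s as)
    case 0
    then obtain t where t: "t \<in> set as" by (cases as) (auto simp: tuple_def)
    with 0 obtain zs where "adr t = s @ zs" "t \<in> adom J"
      by (auto simp: tuple_def below_def prefix_def)
    moreover have "length (adr t) \<le> length s"
      using 0(2) t by simp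
    ultimately have "adr t = s" "t \<in> adom J" by auto
    with 0 in_col_tree_leaf[of t as] show ?case by simp
  next
    case (Suc n)
    show ?case
    proof (cases "s \<in> adr ` adom J")
      case True
      with Suc.prems in_col_tree_leaf show ?thesis by auto
    next
      case False
      have npl: "\<not> pseudoleaf tree (False # s)"
        using False by (auto simp: pseudoleaf_tree)
      have child: "in_col S pal tree ((False # s) @ [i]) (col (s @ [i]) bs) (map ren bs)"
        if "tuple (s @ [i]) bs" "set bs \<subseteq> set as" for i bs
        using Suc.IH[OF that(1)] Suc.prems(2) that(2) by auto
      have recol: ?thesis if "set as \<subseteq> X (s @ [i])" for i
      proof -
        have "tuple (s @ [i]) as"
          using that Suc.prems(1) by (simp add: tuple_def)
        moreover from this have "Recol i (col (s @ [i]) as) (col s as) \<in> tree (False # s)"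
          using False by (auto simp: inner_node recols_def)
        ultimately show ?thesis
          using in_col.recol[OF npl] child by blast
      qed
      show ?thesis
      proof (cases "set as \<subseteq> X (s @ [False]) \<or> set as \<subseteq> X (s @ [True])")
        case True
        with recol show ?thesis by blast
      next
        case mixed: False
        \<comment> \<open>The positions of the entries below the left child. The remaining entries
          lie below the right child, and by \<open>mixed\<close> neither part is empty.\<close>
        define I where "I = {Suc j | j. j < length as \<and> as ! j \<in> X (s @ [False])}"
        have I: "I \<subseteq> {1..length as}" by (auto simp: I_def)
        then obtain bs cs where w: "as = weave I bs cs" "length bs = card I"
            "length bs + length cs = length as"
            "set bs = {as ! i | i. Suc i \<in> I}" "set cs = {as ! i | i. i < length as \<and> Suc i \<notin> I}"
          by (rule weave_surj)
        have as: "set as \<subseteq> X (s @ [False]) \<union> X (s @ [True])"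
          using Suc.prems(1) X_split[OF False] by (simp add: tuple_def)
        have bs: "set bs = set as \<inter> X (s @ [False])"
          unfolding w(4) I_def by (auto simp: in_set_conv_nth)
        have cs: "set cs = set as - X (s @ [False])"
          unfolding w(5) I_def by (auto simp: in_set_conv_nth)
        have M: "length as \<le> M"
          using Suc.prems(1) by (simp add: tuple_def)
        have ne: "bs \<noteq> []" "cs \<noteq> []"
          using bs cs mixed as by auto
        have "set cs \<subseteq> X (s @ [True])"
          using cs as by auto
        then have tb: "tuple (s @ [False]) bs" and tc: "tuple (s @ [True]) cs"
          using ne M w(3) bs by (auto simp: tuple_def)
        have sp: "splitting I bs cs"
          using I w(2,3) M by (simp add: splitting_def)
        have "Add (col (s @ [False]) bs) (col (s @ [True]) cs) I (col s as) \<in> adds s"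
          unfolding adds_def using tb tc sp w(1) by blast
        then have "Add (col (s @ [False]) bs) (col (s @ [True]) cs) I (col s as) \<in> tree (False # s)"
          using False by (simp add: inner_node)
        from in_col.add[OF npl this child[OF tb] child[OF tc]]
        have "in_col S pal tree (False # s) (col s as) (weave I (map ren bs) (map ren cs))"
          using bs cs by auto
        moreover have "map ren as = weave I (map ren bs) (map ren cs)"
          using map_weave[of I bs cs ren] sp w(1) by (simp add: splitting_def)
        ultimately show ?thesis by simp
      qed
    qed
  qed
qed

text \<open>Filling all positions from the tuple, in order and without context, is one of the tests
  recorded in a class. The context \<open>undefined\<close> is never read.\<close>

lemma atom_cls:
  assumes "Atom R as \<in> J" and "length as' = length as" and "cls s as = cls s as'"
  shows "Atom R as' \<in> J"
proof -
  let ?\<pi> = "map Some [0..<length as]"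
  have f: "fill ?\<pi> bs b = bs" if "length bs = length as" for bs b
    unfolding fill_def using that by (auto intro: nth_equalityI)
  have "Atom R (fill ?\<pi> as (\<lambda>_. undefined)) \<in> J"
    unfolding f[OF refl] by (rule assms(1))
  then have "(R, ?\<pi>, \<lambda>_. undefined) \<in> cls s as"
    unfolding cls_def using arity[OF assms(1)] by simp
  then have "Atom R (fill ?\<pi> as' (\<lambda>_. undefined)) \<in> J"
    unfolding assms(3) unfolding cls_def by blast
  then show ?thesis
    unfolding f[OF assms(2)] .
qed

lemma represented_tree:
  "represented S pal tree = (\<lambda>\<alpha>. case \<alpha> of Atom R ts \<Rightarrow> Atom R (map ren ts)) ` J" (is "?rep = ?J")
proof (intro subset_antisym subsetI)
  fix \<alpha> assume "\<alpha> \<in> ?rep"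
  then obtain u where u: "\<alpha> \<in> atoms_at S pal tree u"
    by (auto simp: represented_def)
  show "\<alpha> \<in> ?J"
  proof (cases "pseudoleaf tree u")
    case True
    then obtain t where t: "t \<in> adom J" "u = False # adr t"
      by (auto simp: pseudoleaf_tree)
    then have "tree u = {leaf_dec t}"
      by (simp add: inner_leaf)
    with u True t(2) have "\<alpha> = Atom (Top S) (map ren [t])"
      by (cases t) (auto simp: atoms_at_def ren_def)
    \<comment> \<open>A pseudoleaf emits its \<open>Top\<close> atom unasked, and \<open>top\<close>
      says that \<open>J\<close> has it.\<close>
    then show ?thesis
      using top[OF t(1)] by force
  next
    case False
    have no_radd: "RAdd \<kappa> \<mu> I R \<notin> tree u" for \<kappa> \<mu> I R
    proof -
      have "RAdd \<kappa> \<mu> I R \<noteq> leaf_dec t" for t by (cases t) auto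
      then show ?thesis
        by (auto simp: tree_def inner_def mats_def adds_def recols_def split: list.splits)
    qed
    with u False obtain i \<kappa> R es where \<alpha>: "\<alpha> = Atom R es" "Mat i \<kappa> R \<in> tree u" "in_col S pal tree (u @ [i]) \<kappa> es"
      by (auto simp: atoms_at_def)
    have "Mat i \<kappa> R \<noteq> leaf_dec t" for t by (cases t) auto
    with \<alpha>(2) have "u = [] \<and> Mat i \<kappa> R \<in> mats"
      by (auto simp: tree_def inner_def adds_def recols_def split: list.splits if_splits)
    then obtain as where as: "u = []" "\<not> i" "\<kappa> = col [] as" "Atom R as \<in> J"
      by (auto simp: mats_def)
    with \<alpha>(3) in_col_tree_sound[of "[False]" \<kappa> es "[]"]
    obtain as' where as': "tuple [] as'" "es = map ren as'" "\<kappa> = col [] as'"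
      by auto
    \<comment> \<open>The color only shows that \<open>as'\<close> shares its class with some tuple
      of \<open>R\<close>; membership in \<open>R\<close> is an invariant of that class.\<close>
    note eq = col_eqD[OF tuple_atom[OF as(4)] as'(1)]
    have "Atom R as' \<in> J"
      by (rule atom_cls[OF as(4)]) (use eq as(3) as'(3) in auto)
    then show ?thesis
      using \<alpha>(1) as'(2) by force
  qed
next
  fix \<alpha> assume "\<alpha> \<in> ?J"
  then obtain R as where \<alpha>: "\<alpha> = Atom R (map ren as)" "Atom R as \<in> J"
    by (auto split: atom.splits)
  have "Mat False (col [] as) R \<in> tree []"
    using \<alpha>(2) by (auto simp: mats_def)
  moreover have "in_col S pal tree ([] @ [False]) (col [] as) (map ren as)"
    using in_col_tree_complete[OF tuple_atom[OF \<alpha>(2)]] by simp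
  moreover have "\<not> pseudoleaf tree []"
    by (simp add: pseudoleaf_tree)
  ultimately have "\<alpha> \<in> atoms_at S pal tree []"
    unfolding atoms_at_def \<alpha>(1) by auto
  then show "\<alpha> \<in> ?rep"
    by (auto simp: represented_def)
qed

lemma finite_partitionwidth: "finite_partitionwidth S J"
proof -
  have "adom (represented S pal tree) = ren ` adom J"
    unfolding represented_tree adom_def by (force split: atom.splits)
  then have "bij_betw ren (adom J) (adom (represented S pal tree))"
    using ren_inj by (simp add: bij_betw_def)
  moreover have "\<forall>t\<in>adom J. \<forall>c. ren t = Cst c \<longleftrightarrow> t = Cst c"
    by (auto simp: ren_def split: trm.splits)
  ultimately have "isomorphic J (represented S pal tree)"
    unfolding isomorphic_def using represented_tree by blast
  then show ?thesis
    using finite_partitionwidth_iff palette_for_pal well_decorated_tree by blast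
qed

end

lemma (in addressed_instance) finite_partitionwidth_addressed: "finite_partitionwidth S J"
proof -
  obtain K e where "numbering K e"
    using ex_numbering by blast
  then interpret numbered_instance S J adr K e
    by unfold_locales
  show ?thesis by (rule finite_partitionwidth)
qed

theorem mainTheorem7:
  fixes S :: "('r, 'c) sig" and I :: "('r, ('c, 'n) trm) atom set"
  assumes "signature S"
    and "is_instance S I"
    and "finite_partitionwidth S I"
  shows "(\<forall>P E. P \<in> rels S \<and> ar S P = 2 \<and> rpe_over S E
            \<longrightarrow> finite_partitionwidth S (rpe_extension I P E))
       \<and> (\<forall>R xs \<phi>. R \<in> rels S \<and> fo_over S \<phi> \<and> distinct xs \<and> fv \<phi> = set xs \<and> length xs = ar S R
            \<longrightarrow> finite_partitionwidth S (fo_extension I R xs \<phi>))"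
proof -
  obtain adr where adr: "\<And>t u. t \<in> adom I \<Longrightarrow> u \<in> adom I \<Longrightarrow> prefix (adr t) (adr u) \<Longrightarrow> t = u"
      "\<And>t. t \<in> adom I \<Longrightarrow> Atom (Top S) [t] \<in> I"
      "bounded_instance S (range (below (adom I) adr)) I"
    using finite_partitionwidth_addresses[OF assms(3)] by metis
  \<comment> \<open>The pattern common to both extensions: the active domain is kept, so the
    addresses and the \<open>Top\<close> atoms remain available, and only the index has to be
    bounded anew.\<close>
  have extend: "finite_partitionwidth S J"
    if "I \<subseteq> J" "adom J = adom I" "bounded_instance S (range (below (adom I) adr)) J"
      "\<And>R ts. Atom R ts \<in> J \<Longrightarrow> R \<in> rels S \<and> length ts = ar S R" for J
  proof -
    interpret addressed_instance S J adr
      using that adr assms(1,2) by unfold_locales (auto simp: is_instance_def)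
    show ?thesis by (rule finite_partitionwidth_addressed)
  qed
  have "finite_partitionwidth S (rpe_extension I P E)"
    if "P \<in> rels S" "ar S P = 2" "rpe_over S E" for P E
  proof (rule extend)
    show "bounded_instance S (range (below (adom I) adr)) (rpe_extension I P E)"
      by (rule bounded_instance_rpe_extension[OF adr(3) that(3,2)])
    show "R \<in> rels S \<and> length ts = ar S R" if "Atom R ts \<in> rpe_extension I P E" for R ts
      using that \<open>P \<in> rels S\<close> \<open>ar S P = 2\<close> assms(2) by (auto simp: rpe_extension_def is_instance_def)
  qed (auto simp: rpe_extension_def adom_rpe_extension[unfolded rpe_extension_def])
  moreover have "finite_partitionwidth S (fo_extension I R xs \<phi>)"
    if "R \<in> rels S" "fo_over S \<phi>" "distinct xs" "fv \<phi> = set xs" "length xs = ar S R" for R xs \<phi>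
  proof (rule extend)
    show "bounded_instance S (range (below (adom I) adr)) (fo_extension I R xs \<phi>)"
      by (rule bounded_instance_fo_extension[OF adr(3) that(2-5)])
    show "Q \<in> rels S \<and> length ts = ar S Q" if "Atom Q ts \<in> fo_extension I R xs \<phi>" for Q ts
      using that \<open>R \<in> rels S\<close> \<open>length xs = ar S R\<close> assms(2) by (auto simp: fo_extension_def is_instance_def)
  qed (auto simp: fo_extension_def adom_fo_extension[unfolded fo_extension_def])
  ultimately show ?thesis by blast
qed

end
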